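(* Let $\mathcal{H}\subseteq\{0,1\}^{\mathcal{X}}$ be any hypothesis class with an infinite Littlestone dimension (e.g., the class of thresholds over $\mathbb{R}$). Then any semi-private learner for $\mathcal{H}$ must have public sample of size $n_{\mathsf{pub}}=\Omega(1/\alpha)$, where $\alpha$ is the excess error.
   Context: Setting: $\mathcal{X}$ is a domain, $\mathcal{Z}=\mathcal{X}\times\{0,1\}$, and for a distribution $\mathcal{D}$ over $\mathcal{Z}$ and $h:\mathcal{X}\to\{0,1\}$, $\mathrm{err}(h;\mathcal{D})=\Pr_{(x,y)\sim\mathcal{D}}[h(x)\neq y]$. Littlestone dimension: the largest $k$ such that there is a complete binary tree of depth $k$, with internal nodes labeled by points of $\mathcal{X}$, that is shattered by $\mathcal{H}$ (for every root-to-leaf path, viewed as a sequence $(x_1,y_1),\dots,(x_k,y_k)$ with $y_i\in\{0,1\}$ the direction taken at node $x_i$, some $h\in\mathcal{H}$ satisfies $h(x_i)=y_i$ for all $i$). It is infinite if such trees exist for every $k$. Differential privacy: a randomized algorithm $\mathcal{M}$ on datasets is $(\epsilon,\delta)$-differentially private if for all datasets $S,S'$ differing in exactly one data point and every measurable set $O$ of outputs, $\Pr[\mathcal{M}(S)\in O]\le e^{\epsilon}\Pr[\mathcal{M}(S')\in O]+\delta$. $(\alpha,\beta,\epsilon,\delta)$-semi-private learner for $\mathcal{H}$ with private sample size $n_{\mathsf{priv}}$ and public sample size $n_{\mathsf{pub}}$: a randomized algorithm $\mathcal{A}$ such that (1) for every distribution $\mathcal{D}$ over $\mathcal{Z}$,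 given labeled datasets $S_{\mathsf{priv}}\sim\mathcal{D}^{n_{\mathsf{priv}}}$ and $S_{\mathsf{pub}}\sim\mathcal{D}^{n_{\mathsf{pub}}}$, with probability at least $1-\beta$ over the samples and the coins of $\mathcal{A}$, the output $\hat h=\mathcal{A}(S_{\mathsf{priv}},S_{\mathsf{pub}})\in\{0,1\}^{\mathcal{X}}$ (not necessarily in $\mathcal{H}$) satisfies $\mathrm{err}(\hat h;\mathcal{D})\le\inf_{h\in\mathcal{H}}\mathrm{err}(h;\mathcal{D})+\alpha$; and (2) for every $S\in\mathcal{Z}^{n_{\mathsf{pub}}}$, $\mathcal{A}(\cdot,S)$ is $(\epsilon,\delta)$-differentially private. Here $\alpha$ is called the excess error. Semi-private learner for $\mathcal{H}$ (without parameters): an algorithm $\mathcal{A}$ together with functions $n_{\mathsf{priv}},n_{\mathsf{pub}}:(0,1)^2\to\mathbb{N}$ (where $0$ is allowed as a value of $n_{\mathsf{pub}}$), with $n_{\mathsf{pub}}(\alpha,\cdot)=o(1/\alpha^2)$, such that for every $\alpha,\beta\in(0,1)$, when given private and public samples of sizes $n_{\mathsf{priv}}=n_{\mathsf{priv}}(\alpha,\beta)$ and $n_{\mathsf{pub}}=n_{\mathsf{pub}}(\alpha,\beta)$, $\mathcal{A}$ is an $(\alpha,\beta,0.1,\delta(n_{\mathsf{priv}}))$-semi-private learner for $\mathcal{H}$, where $\delta(\cdot)$ is a negligible function (i.e. $\delta(n)=o(n^{-t})$ for every $t\in\mathbb{N}$). *)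

theory Defs
  imports "HOL-Probability.Probability" "HOL-Library.Landau_Symbols" "HOL-Library.Tree"
begin

text \<open>
  The domain is a type \<open>'x\<close> with a sigma-algebra \<open>MX\<close> on it; labels are Booleans.
  Hypotheses are Boolean functions on the domain.  The sigma-algebra \<open>MH\<close> on the set of
  hypotheses, which is the one that ``measurable set of outputs'' refers to, is a parameter.
\<close>

section \<open>Littlestone dimension\<close>

fun branches :: "'x tree \<Rightarrow> ('x \<times> bool) list set" where
  "branches Leaf = {[]}"
| "branches (Node l x r) =
     (\<lambda>p. (x, False) # p) ` branches l \<union> (\<lambda>p. (x, True) # p) ` branches r"

definition shatters :: "('x \<Rightarrow> bool) set \<Rightarrow> 'x tree \<Rightarrow> bool" where
  "shatters H T \<longleftrightarrow> (\<forall>p\<in>branches T. \<exists>h\<in>H. \<forall>(x, y)\<in>set p. h x = y)"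

definition littlestone_dim :: "('x \<Rightarrow> bool) set \<Rightarrow> enat" where
  "littlestone_dim H =
     (SUP T\<in>{T. Tree.complete T \<and> shatters H T}. enat (height T))"

section \<open>Distributions, hypotheses and error\<close>

abbreviation example_space :: "'x measure \<Rightarrow> ('x \<times> bool) measure" where
  "example_space MX \<equiv> MX \<Otimes>\<^sub>M count_space UNIV"

definition distribution_on :: "'a measure \<Rightarrow> 'a measure \<Rightarrow> bool" where
  "distribution_on M D \<longleftrightarrow> prob_space D \<and> sets D = sets M"

text \<open>
  The space of outputs consists of all measurable hypotheses, since the error of a
  non-measurable one is not defined (and \<^const>\<open>measure\<close> would silently return 0).
  The product sigma-algebra would be too small a choice for \<open>MH\<close> in general, as the error
  with respect to a non-atomic distribution is not measurable for it.
\<close>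

definition hypothesis_space :: "'x measure \<Rightarrow> ('x \<Rightarrow> bool) measure \<Rightarrow> bool" where
  "hypothesis_space MX MH \<longleftrightarrow>
     space MH = measurable MX (count_space UNIV) \<and>
     (\<forall>x. (\<lambda>h. h x) \<in> measurable MH (count_space UNIV))"

definition err :: "('x \<times> bool) measure \<Rightarrow> ('x \<Rightarrow> bool) \<Rightarrow> real" where
  "err D h = \<P>(z in D. h (fst z) \<noteq> snd z)"

section \<open>Differential privacy\<close>

definition neighbouring :: "'z list \<Rightarrow> 'z list \<Rightarrow> bool" where
  "neighbouring S S' \<longleftrightarrow>
     length S = length S' \<and> (\<exists>!i. i < length S \<and> S ! i \<noteq> S' ! i)"

text \<open>\<open>n\<close> is the size of the datasets, \<open>N\<close> the measurable space of outputs.\<close>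

definition differentially_private ::
  "nat \<Rightarrow> 'o measure \<Rightarrow> real \<Rightarrow> real \<Rightarrow> ('z list \<Rightarrow> 'o measure) \<Rightarrow> bool" where
  "differentially_private n N \<epsilon> \<delta> M \<longleftrightarrow>
     (\<forall>S S'. length S = n \<and> length S' = n \<and> neighbouring S S' \<longrightarrow>
        (\<forall>E\<in>sets N. measure (M S) E \<le> exp \<epsilon> * measure (M S') E + \<delta>))"

section \<open>Semi-private learners\<close>

text \<open>
  A learning algorithm maps a private and a public dataset, of arbitrary sizes, to the
  distribution of its output.  Samples of size \<open>n\<close> are elements of an \<open>n\<close>-fold product space
  indexed by \<open>{..<n}\<close>; the function \<open>dataset n\<close> turns them into lists.
\<close>

type_synonym 'x algo =
  "('x \<times> bool) list \<Rightarrow> ('x \<times> bool) list \<Rightarrow> ('x \<Rightarrow> bool) measure"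

definition dataset :: "nat \<Rightarrow> (nat \<Rightarrow> 'z) \<Rightarrow> 'z list" where
  "dataset n S = map S [0..<n]"

definition sample :: "nat \<Rightarrow> 'z measure \<Rightarrow> (nat \<Rightarrow> 'z) measure" where
  "sample n D = (\<Pi>\<^sub>M i\<in>{..<n}. D)"

definition randomized_algorithm ::
  "'x measure \<Rightarrow> ('x \<Rightarrow> bool) measure \<Rightarrow> 'x algo \<Rightarrow> bool" where
  "randomized_algorithm MX MH A \<longleftrightarrow>
     (\<forall>n m. (\<lambda>(S, T). A (dataset n S) (dataset m T))
        \<in> measurable (sample n (example_space MX) \<Otimes>\<^sub>M sample m (example_space MX))
            (prob_algebra MH))"

text \<open>The distribution of the output, over both samples and the coins of the algorithm.\<close>

definition output_distribution ::
  "'x algo \<Rightarrow> nat \<Rightarrow> nat \<Rightarrow> ('x \<times> bool) measure \<Rightarrow> ('x \<Rightarrow> bool) measure" where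
  "output_distribution A n m D =
     (sample n D \<Otimes>\<^sub>M sample m D) \<bind> (\<lambda>(S, T). A (dataset n S) (dataset m T))"

text \<open>
  In the accuracy condition, a lower bound \<open>1 - \<beta> > 0\<close> entails that the event is measurable,
  as \<^const>\<open>measure\<close> is 0 on non-measurable sets.
\<close>

definition semi_private_learner_with ::
  "'x measure \<Rightarrow> ('x \<Rightarrow> bool) measure \<Rightarrow> ('x \<Rightarrow> bool) set \<Rightarrow> 'x algo \<Rightarrow>
   nat \<Rightarrow> nat \<Rightarrow> real \<Rightarrow> real \<Rightarrow> real \<Rightarrow> real \<Rightarrow> bool" where
  "semi_private_learner_with MX MH H A n_priv n_pub \<alpha> \<beta> \<epsilon> \<delta> \<longleftrightarrow>
     (\<forall>D. distribution_on (example_space MX) D \<longrightarrow>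
        \<P>(h in output_distribution A n_priv n_pub D. err D h \<le> (INF h'\<in>H. err D h') + \<alpha>)
          \<ge> 1 - \<beta>) \<and>
     (\<forall>T. length T = n_pub \<longrightarrow> differentially_private n_priv MH \<epsilon> \<delta> (\<lambda>S. A S T))"

definition negligible_fun :: "(nat \<Rightarrow> real) \<Rightarrow> bool" where
  "negligible_fun \<delta> \<longleftrightarrow> (\<forall>t::nat. \<delta> \<in> o(\<lambda>n. 1 / real n ^ t))"

definition semi_private_learner ::
  "'x measure \<Rightarrow> ('x \<Rightarrow> bool) measure \<Rightarrow> ('x \<Rightarrow> bool) set \<Rightarrow> 'x algo \<Rightarrow>
   (real \<Rightarrow> real \<Rightarrow> nat) \<Rightarrow> (real \<Rightarrow> real \<Rightarrow> nat) \<Rightarrow> bool" where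
  "semi_private_learner MX MH H A n_priv n_pub \<longleftrightarrow>
     randomized_algorithm MX MH A \<and>
     (\<forall>\<beta>\<in>{0<..<1}. (\<lambda>\<alpha>. real (n_pub \<alpha> \<beta>)) \<in> o[at_right 0](\<lambda>\<alpha>. 1 / \<alpha>\<^sup>2)) \<and>
     (\<exists>\<delta>. negligible_fun \<delta> \<and>
        (\<forall>\<alpha>\<in>{0<..<1}. \<forall>\<beta>\<in>{0<..<1}.
           semi_private_learner_with MX MH H A (n_priv \<alpha> \<beta>) (n_pub \<alpha> \<beta>)
             \<alpha> \<beta> (1/10) (\<delta> (n_priv \<alpha> \<beta>))))"

end

theory Submission
  imports Defs "HOL-Library.Ramsey"
begin

text \<open>
  A class of infinite Littlestone dimension contains threshold sequences of every length.
  Mix a distribution on such a sequence with a dummy example of weight \<open>1 - 1 / \<rho>\<close>, where \<open>\<rho>\<close>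
  is a constant times \<open>n_pub\<close>.  If \<open>\<alpha> n_pub\<close> is small, then the public sample most likely consists
  of dummies only, while an excess error \<open>\<alpha>\<close> on the mixture is an excess error \<open>\<alpha> \<rho>\<close>, still below
  a constant, on the thresholds.  This leaves a private learner without public data for thresholds,
  with a success probability that is merely bounded away from 0.

  Such a learner is impossible.  By Ramsey's theorem the joint law of any two values of the output
  depends, up to \<open>\<eta>\<close>, only on the gaps between private sample points in which the two arguments lie.
  So the average of the output over a long block of points in a gap is, up to a small error in
  \<open>L\<^sup>2\<close>, a random variable attached to the gap, and accuracy forces it to jump between two adjacent
  gaps.  Moving the sample point that separates them to one of \<open>J\<close> positions changes the output law
  little, by privacy, but the position can be read off from the block averages; for large \<open>J\<close> this is
  a contradiction.  It needs \<open>\<delta>\<close> to be at most of order \<open>n_priv\<^sup>-\<^sup>2\<close>, which negligibility gives only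
  for large \<open>n_priv\<close>; if \<open>n_priv\<close> is bounded, the private sample is most likely all dummies, too, and
  the output cannot fit several thresholds at once.
\<close>

section \<open>Thresholds and homogeneous subsequences\<close>

text \<open>The tree stays implicit: only its depth is recorded, and its node labels are confined to
  \<open>X\<close>. Confining them allows a tree to be split along a partition of the
  domain.\<close>

fun lshatters :: "'x set \<Rightarrow> ('x \<Rightarrow> bool) set \<Rightarrow> nat \<Rightarrow> bool" where
  "lshatters X H 0 \<longleftrightarrow> H \<noteq> {}"
| "lshatters X H (Suc d) \<longleftrightarrow> (\<exists>x\<in>X. \<forall>b. lshatters X {h\<in>H. h x = b} d)"

lemma lshatters_mono:
  "lshatters X H d \<Longrightarrow> X \<subseteq> Y \<Longrightarrow> H \<subseteq> G \<Longrightarrow> lshatters Y G d"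
proof (induction d arbitrary: H G)
  case 0
  then show ?case by auto
next
  case (Suc d)
  from Suc.prems(1) obtain x where x: "x \<in> X" "\<And>b. lshatters X {h\<in>H. h x = b} d"
    by auto
  have "lshatters Y {h\<in>G. h x = b} d" for b
    using Suc.prems(3) by (intro Suc.IH[OF x(2) Suc.prems(2)]) auto
  with x(1) Suc.prems(2) show ?case by auto
qed

lemma lshatters_nonempty: "lshatters X H d \<Longrightarrow> H \<noteq> {}"
proof (induction d arbitrary: H)
  case (Suc d)
  then obtain x where "\<forall>b. lshatters X {h\<in>H. h x = b} d" by auto
  from Suc.IH[OF this[rule_format]] show ?case by blast
qed simp

text \<open>A Ramsey argument for trees. If the root label lies in \<open>X\<close>, then either
  both subtrees contain an \<open>X\<close>-tree of depth \<open>a - 1\<close>, and the root joins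
  them, or one of them already contains a \<open>Y\<close>-tree of depth \<open>b\<close>. The other
  case is symmetric.\<close>

lemma lshatters_split:
  assumes "lshatters (X \<union> Y) H (a + b)"
  shows "lshatters X H a \<or> lshatters Y H b"
  using assms
proof (induction "a + b" arbitrary: a b H)
  case 0
  then show ?case by simp
next
  case (Suc d)
  have ne: "H \<noteq> {}"
    using lshatters_nonempty Suc.prems by blast
  show ?case
  proof (cases "a = 0 \<or> b = 0")
    case True
    with ne show ?thesis by auto
  next
    case False
    then obtain a' b' where ab: "a = Suc a'" "b = Suc b'"
      by (auto simp: gr0_conv_Suc)
    from Suc.prems Suc.hyps(2)[symmetric] obtain x where x: "x \<in> X \<union> Y"
      and lx: "\<And>c. lshatters (X \<union> Y) {h\<in>H. h x = c} d"
      by auto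
    have sub: "lshatters Z {h\<in>H. h x = c} e \<Longrightarrow> lshatters Z H e" for Z c e
      by (rule lshatters_mono) auto
    show ?thesis
    proof (cases "x \<in> X")
      case True
      have "d = a' + b" using Suc.hyps(2) ab by simp
      then have "lshatters X {h\<in>H. h x = c} a' \<or> lshatters Y {h\<in>H. h x = c} b" for c
        using Suc.hyps(1)[of a' b "{h\<in>H. h x = c}"] lx[of c] by simp
      then show ?thesis
        using True sub unfolding ab(1) lshatters.simps by blast
    next
      case False
      with x have "x \<in> Y" by simp
      have "d = a + b'" using Suc.hyps(2) ab by simp
      then have "lshatters X {h\<in>H. h x = c} a \<or> lshatters Y {h\<in>H. h x = c} b'" for c
        using Suc.hyps(1)[of a b' "{h\<in>H. h x = c}"] lx[of c] by simp
      then show ?thesis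
        using \<open>x \<in> Y\<close> sub unfolding ab(2) lshatters.simps by blast
    qed
  qed
qed

lemma shatters_lshatters:
  "Tree.complete T \<Longrightarrow> shatters H T \<Longrightarrow> lshatters UNIV H (height T)"
proof (induction T arbitrary: H)
  case Leaf
  then show ?case by (auto simp: shatters_def)
next
  case (Node l x r)
  have "shatters {h\<in>H. h x = False} l" "shatters {h\<in>H. h x = True} r"
    using Node.prems(2) unfolding shatters_def branches.simps ball_Un ball_simps
    by (auto simp: Bex_def)
  then have "lshatters UNIV {h\<in>H. h x = False} (height l)"
    "lshatters UNIV {h\<in>H. h x = True} (height r)"
    using Node.prems(1) by (intro Node.IH; simp)+
  moreover have "height l = height r"
    using Node.prems(1) by simp
  ultimately have "lshatters UNIV {h\<in>H. h x = False} (height l)"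
    "lshatters UNIV {h\<in>H. h x = True} (height l)"
    by simp_all
  then have "lshatters UNIV {h\<in>H. h x = b} (height l)" for b
    by (cases b) auto
  with Node.prems(1) show ?case by auto
qed

text \<open>Splitting with an empty second set suffices, since no tree of positive depth takes its
  labels from there.\<close>

lemma lshatters_decreasing:
  assumes "lshatters X H d" "e \<le> d"
  shows "lshatters X H e"
proof -
  from assms have "lshatters (X \<union> {}) H (e + (d - e))" by simp
  then have "lshatters X H e \<or> lshatters {} H (d - e)"
    by (rule lshatters_split)
  moreover have "lshatters {} H (d - e) \<Longrightarrow> d - e = 0"
    by (cases "d - e") auto
  ultimately show ?thesis using assms by (cases "d = e") auto
qed

lemma littlestone_dim_infinite:
  assumes "littlestone_dim H = \<infinity>"
  shows "lshatters UNIV H d"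
proof -
  have "enat d < (SUP T\<in>{T. Tree.complete T \<and> shatters H T}. enat (height T))"
    using assms unfolding littlestone_dim_def by simp
  then obtain T where "Tree.complete T" "shatters H T" "d < height T"
    unfolding less_SUP_iff by auto
  then show ?thesis
    using shatters_lshatters lshatters_decreasing by (metis less_imp_le)
qed

text \<open>The flag \<open>c\<close> is the value of each hypothesis at the points from its own
  index on. It is left open because the extraction from a tree does not control which of the two
  orientations it yields.\<close>

definition threshold_seq ::
  "bool \<Rightarrow> 'x set \<Rightarrow> ('x \<Rightarrow> bool) set \<Rightarrow> nat \<Rightarrow> (nat \<Rightarrow> 'x) \<Rightarrow> (nat \<Rightarrow> 'x \<Rightarrow> bool) \<Rightarrow> bool" where
  "threshold_seq c X H k u h \<longleftrightarrow>
     (\<forall>i<k. u i \<in> X \<and> h i \<in> H) \<and> (\<forall>i<k. \<forall>j<k. h i (u j) = ((i \<le> j) = c))"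

text \<open>Splitting the tree by the values of a single hypothesis and descending into the
  branch that disagrees with it yields the next point of the sequence.\<close>

lemma lshatters_threshold_seq:
  "\<exists>d. \<forall>X (H::('x \<Rightarrow> bool) set). lshatters X H d \<longrightarrow>
     (\<exists>u h. threshold_seq True X H a u h) \<or> (\<exists>u h. threshold_seq False X H b u h)"
proof (induction "a + b" arbitrary: a b rule: less_induct)
  case less
  show ?case
  proof (cases "a = 0 \<or> b = 0")
    case True
    then have "threshold_seq True X H a u h \<or> threshold_seq False X H b u h"
      for X and H :: "('x \<Rightarrow> bool) set" and u h
      by (auto simp: threshold_seq_def)
    then show ?thesis by blast
  next
    case False
    then obtain a' b' where ab: "a = Suc a'" "b = Suc b'"
      by (auto simp: gr0_conv_Suc)
    let ?P = "\<lambda>a b d. \<forall>X (H::('x \<Rightarrow> bool) set). lshatters X H d \<longrightarrow>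
     (\<exists>u h. threshold_seq True X H a u h) \<or> (\<exists>u h. threshold_seq False X H b u h)"
    obtain d1 where d1: "?P a' b d1"
      using less[of a' b] ab by auto
    obtain d2 where d2: "?P a b' d2"
      using less[of a b'] ab by auto
    \<comment> \<open>\<open>g\<close> becomes hypothesis number 0: it has the value
      \<open>c\<close> at the new point and at all later ones, whereas the old hypotheses have the
      opposite value at the new point.\<close>
    have ext: "\<exists>u h. threshold_seq c X H (Suc k) u h"
      if "g \<in> H" "x \<in> X" "g x = c" "\<forall>y\<in>Y. g y = c" "Y \<subseteq> X"
        "threshold_seq c Y {f\<in>H. f x = (\<not> c)} k u h"
      for c X Y k g x u h and H :: "('x \<Rightarrow> bool) set"
    proof (intro exI)
      show "threshold_seq c X H (Suc k) (case_nat x u) (case_nat g h)"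
        using that by (auto simp: threshold_seq_def less_Suc_eq_0_disj)
    qed
    have mono: "\<exists>u h. threshold_seq c X H k u h" if "threshold_seq c Y G k u h" "Y \<subseteq> X" "G \<subseteq> H"
      for c X Y k G u h and H :: "('x \<Rightarrow> bool) set"
      using that by (intro exI[of _ u] exI[of _ h]) (auto simp: threshold_seq_def)
    \<comment> \<open>Splitting by the value of \<open>g\<close> leaves depth \<open>Suc d1\<close>
      or \<open>Suc d2\<close>. The root of that tree is the new point, and one of its subtrees, of
      depth \<open>d1\<close> or \<open>d2\<close>, has all its hypotheses disagree with
      \<open>g\<close> there.\<close>
    have "?P a b (Suc d1 + Suc d2)"
    proof (intro allI impI)
      fix X and H :: "('x \<Rightarrow> bool) set"
      assume L: "lshatters X H (Suc d1 + Suc d2)"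
      then obtain g where g: "g \<in> H"
        using lshatters_nonempty by blast
      let ?X = "\<lambda>c. {x\<in>X. g x = c}"
      have "X = ?X True \<union> ?X False" by auto
      with L lshatters_split consider "lshatters (?X True) H (Suc d1)" | "lshatters (?X False) H (Suc d2)"
        by metis
      then show "(\<exists>u h. threshold_seq True X H a u h) \<or> (\<exists>u h. threshold_seq False X H b u h)"
      proof cases
        case 1
        then obtain x where x: "x \<in> X" "g x" "lshatters (?X True) {f\<in>H. f x = False} d1"
          unfolding lshatters.simps by blast
        from d1 x(3) consider
          u h where "threshold_seq True (?X True) {f\<in>H. f x = False} a' u h" |
          u h where "threshold_seq False (?X True) {f\<in>H. f x = False} b u h"
          by blast
        then show ?thesis
        proof cases
          case 1
          then show ?thesis
            using ext[of g H x X True "?X True" a'] g x ab by auto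
        next
          case 2
          then show ?thesis using mono[OF 2, of X H] by blast
        qed
      next
        case 2
        then obtain x where x: "x \<in> X" "\<not> g x" "lshatters (?X False) {f\<in>H. f x = True} d2"
          unfolding lshatters.simps by blast
        from d2 x(3) consider
          u h where "threshold_seq True (?X False) {f\<in>H. f x = True} a u h" |
          u h where "threshold_seq False (?X False) {f\<in>H. f x = True} b' u h"
          by blast
        then show ?thesis
        proof cases
          case 1
          then show ?thesis using mono[OF 1, of X H] by blast
        next
          case 2
          then show ?thesis
            using ext[of g H x X False "?X False" b'] g x ab by auto
        qed
      qed
    qed
    then show ?thesis by blast
  qed
qed

corollary infinite_littlestone_thresholds:
  assumes "littlestone_dim H = \<infinity>"
  obtains c u h where "threshold_seq c UNIV H k u h"
proof -
  obtain d where d: "\<forall>X (H::('a \<Rightarrow> bool) set). lshatters X H d \<longrightarrow>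
     (\<exists>u h. threshold_seq True X H k u h) \<or> (\<exists>u h. threshold_seq False X H k u h)"
    using lshatters_threshold_seq by blast
  show thesis
    using d littlestone_dim_infinite[OF assms, of d] that by blast
qed

text \<open>A tuple is coloured with the vector of the functions' values, rounded to multiples of \<open>\<eta>\<close>.\<close>

lemma ramsey_approx:
  fixes P :: "'p set" and \<eta> :: real and N r :: nat
  assumes "finite P" "\<eta> > 0"
  shows "\<exists>M. \<forall>F :: 'p \<Rightarrow> nat list \<Rightarrow> real. (\<forall>p xs. 0 \<le> F p xs \<and> F p xs \<le> 1) \<longrightarrow>
    (\<exists>w. strict_mono_on {..<N} w \<and> w ` {..<N} \<subseteq> {..<M} \<and>
      (\<forall>p\<in>P. \<forall>f g. strict_mono_on {..<r} f \<longrightarrow> strict_mono_on {..<r} g \<longrightarrow>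
         f ` {..<r} \<subseteq> {..<N} \<longrightarrow> g ` {..<r} \<subseteq> {..<N} \<longrightarrow>
         \<bar>F p (map (w \<circ> f) [0..<r]) - F p (map (w \<circ> g) [0..<r])\<bar> \<le> \<eta>))"
proof -
  define q where "q = nat \<lfloor>1 / \<eta>\<rfloor>"
  define C where "C = P \<rightarrow>\<^sub>E {..q}"
  have finC: "finite C"
    unfolding C_def using assms by (intro finite_PiE) auto
  then obtain num where num: "bij_betw num C {..<card C}"
    using ex_bij_betw_finite_nat[of C] atLeast0LessThan by auto
  \<comment> \<open>\<open>M\<close> depends only on the number of colours, \<open>N\<close> and
    \<open>r\<close>. So \<open>F\<close> may be chosen after \<open>M\<close>, which matters later:
    it comes from a threshold sequence longer than \<open>M\<close>.\<close>
  obtain M :: nat where M: "partn_lst {..<M} (replicate (card C) N) r"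
    using ramsey_full by blast
  show ?thesis
  proof (rule exI[of _ M], intro allI impI)
    fix F :: "'p \<Rightarrow> nat list \<Rightarrow> real"
    assume F: "\<forall>p xs. 0 \<le> F p xs \<and> F p xs \<le> 1"
    define col where "col V = (\<lambda>p\<in>P. nat \<lfloor>F p (sorted_list_of_set V) / \<eta>\<rfloor>)" for V
    have col: "col V \<in> C" for V
      unfolding col_def C_def q_def using F assms
      by (auto intro!: nat_mono floor_mono divide_right_mono)
    have "(\<lambda>V. num (col V)) \<in> nsets {..<M} r \<rightarrow> {..<card C}"
      using col num by (auto simp: bij_betw_def)
    then obtain i W where i: "i < card C" and W: "W \<in> nsets {..<M} N"
      and mono: "(\<lambda>V. num (col V)) ` nsets W r \<subseteq> {i}"
      by (rule partn_lstE[OF M]) (auto simp: nth_replicate)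
    have fW: "finite W" "card W = N" "W \<subseteq> {..<M}"
      using W by (auto simp: nsets_def)
    define w where "w = (\<lambda>k. sorted_list_of_set W ! k)"
    have lenW: "length (sorted_list_of_set W) = N"
      using fW by simp
    have smw: "strict_mono_on {..<N} w"
      unfolding w_def strict_mono_on_def
      using fW lenW by (auto simp: sorted_wrt_nth_less)
    have wW: "w ` {..<N} \<subseteq> W"
      unfolding w_def using lenW fW by (metis image_subsetI lessThan_iff nth_mem set_sorted_list_of_set)
    \<comment> \<open>An increasing tuple is recovered from its set of values by sorting, so
      colouring \<open>r\<close>-subsets amounts to colouring increasing tuples.\<close>
    have key: "num (col (set (map (w \<circ> f) [0..<r]))) = i \<and>
        sorted_list_of_set (set (map (w \<circ> f) [0..<r])) = map (w \<circ> f) [0..<r]"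
      if f: "strict_mono_on {..<r} f" "f ` {..<r} \<subseteq> {..<N}" for f
    proof -
      have sm: "strict_mono_on {..<r} (w \<circ> f)"
        using smw f unfolding strict_mono_on_def by (auto simp: image_subset_iff)
      have sor: "sorted_wrt (<) (map (w \<circ> f) [0..<r])"
        unfolding sorted_wrt_iff_nth_less using sm by (auto simp: strict_mono_on_def)
      have "card (set (map (w \<circ> f) [0..<r])) = r"
        using sor by (subst distinct_card) (auto simp: strict_sorted_iff)
      moreover have "set (map (w \<circ> f) [0..<r]) \<subseteq> W"
        using wW f(2) by (auto simp: image_subset_iff)
      ultimately have "set (map (w \<circ> f) [0..<r]) \<in> nsets W r"
        by (simp add: nsets_def)
      then show ?thesis
        using mono sor by (auto simp: strict_sorted_iff intro!: sorted_distinct_set_unique)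
    qed
    have "strict_mono_on {..<N} w \<and> w ` {..<N} \<subseteq> {..<M} \<and>
      (\<forall>p\<in>P. \<forall>f g. strict_mono_on {..<r} f \<longrightarrow> strict_mono_on {..<r} g \<longrightarrow>
         f ` {..<r} \<subseteq> {..<N} \<longrightarrow> g ` {..<r} \<subseteq> {..<N} \<longrightarrow>
         \<bar>F p (map (w \<circ> f) [0..<r]) - F p (map (w \<circ> g) [0..<r])\<bar> \<le> \<eta>)"
    proof (intro conjI ballI allI impI smw)
      show "w ` {..<N} \<subseteq> {..<M}" using wW fW by blast
    next
      fix p f g
      assume p: "p \<in> P"
        and fg: "strict_mono_on {..<r} f" "strict_mono_on {..<r} g"
          "f ` {..<r} \<subseteq> {..<N}" "g ` {..<r} \<subseteq> {..<N}"
      have "col (set (map (w \<circ> f) [0..<r])) = col (set (map (w \<circ> g) [0..<r]))"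
        using key[OF fg(1,3)] key[OF fg(2,4)] col num by (metis bij_betw_def inj_onD)
      then have "nat \<lfloor>F p (map (w \<circ> f) [0..<r]) / \<eta>\<rfloor> = nat \<lfloor>F p (map (w \<circ> g) [0..<r]) / \<eta>\<rfloor>"
        using p key[OF fg(1,3)] key[OF fg(2,4)] by (auto simp: col_def dest!: fun_cong[of _ _ p])
      moreover have "0 \<le> \<lfloor>F p (map (w \<circ> f) [0..<r]) / \<eta>\<rfloor>" "0 \<le> \<lfloor>F p (map (w \<circ> g) [0..<r]) / \<eta>\<rfloor>"
        using F assms by auto
      ultimately have "\<lfloor>F p (map (w \<circ> f) [0..<r]) / \<eta>\<rfloor> = \<lfloor>F p (map (w \<circ> g) [0..<r]) / \<eta>\<rfloor>"
        by (metis eq_nat_nat_iff)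
      then have "\<bar>F p (map (w \<circ> f) [0..<r]) / \<eta> - F p (map (w \<circ> g) [0..<r]) / \<eta>\<bar> \<le> 1"
        by linarith
      then have "\<bar>F p (map (w \<circ> f) [0..<r]) - F p (map (w \<circ> g) [0..<r])\<bar> / \<eta> \<le> 1"
        using assms by (simp add: diff_divide_distrib[symmetric])
      then show "\<bar>F p (map (w \<circ> f) [0..<r]) - F p (map (w \<circ> g) [0..<r])\<bar> \<le> \<eta>"
        using assms by simp
    qed
    then show "\<exists>w. strict_mono_on {..<N} w \<and> w ` {..<N} \<subseteq> {..<M} \<and>
      (\<forall>p\<in>P. \<forall>f g. strict_mono_on {..<r} f \<longrightarrow> strict_mono_on {..<r} g \<longrightarrow>
         f ` {..<r} \<subseteq> {..<N} \<longrightarrow> g ` {..<r} \<subseteq> {..<N} \<longrightarrow>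
         \<bar>F p (map (w \<circ> f) [0..<r]) - F p (map (w \<circ> g) [0..<r])\<bar> \<le> \<eta>)"
      by blast
  qed
qed

section \<open>Homogeneous private mechanisms\<close>

lemma (in prob_space) expectation_le_threshold:
  fixes f :: "'a \<Rightarrow> real"
  assumes [measurable]: "f \<in> borel_measurable M"
    and f: "\<And>x. 0 \<le> f x" "\<And>x. f x \<le> 1" and t: "0 \<le> t"
  shows "expectation f \<le> t + prob {x\<in>space M. t \<le> f x}"
proof -
  have "expectation f \<le> expectation (\<lambda>x. t + indicator {x\<in>space M. t \<le> f x} x)"
  proof (rule integral_mono)
    show "integrable M f"
      by (rule integrable_const_bound[where B = 1]) (use f in auto)
    show "integrable M (\<lambda>x. t + indicat_real {x\<in>space M. t \<le> f x} x)"
      by (rule integrable_const_bound[where B = "t + 1"]) (use t in \<open>auto simp: indicator_def\<close>)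
    show "f x \<le> t + indicat_real {x\<in>space M. t \<le> f x} x" if "x \<in> space M" for x
      using f(2)[of x] t that by (auto simp: indicator_def)
  qed
  also have "\<dots> = t + prob {x\<in>space M. t \<le> f x}"
  proof (subst Bochner_Integration.integral_add)
    show "integrable M (indicat_real {x\<in>space M. t \<le> f x})"
      by (rule integrable_const_bound[where B = 1]) (auto simp: indicator_def)
  qed (auto simp: prob_space)
  finally show ?thesis .
qed

lemma (in prob_space) prob_threshold_le:
  fixes f :: "'a \<Rightarrow> real"
  assumes [measurable]: "f \<in> borel_measurable M"
    and f: "\<And>x. 0 \<le> f x" "\<And>x. f x \<le> 1" and t: "0 < t"
  shows "prob {x\<in>space M. t \<le> f x} \<le> expectation f / t"
proof -
  have "t * prob {x\<in>space M. t \<le> f x} = expectation (\<lambda>x. t * indicator {x\<in>space M. t \<le> f x} x)"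
    by simp
  also have "\<dots> \<le> expectation f"
  proof (rule integral_mono)
    show "integrable M f"
      by (rule integrable_const_bound[where B = 1]) (use f in auto)
    show "integrable M (\<lambda>x. t * indicat_real {x\<in>space M. t \<le> f x} x)"
      by (rule integrable_const_bound[where B = t]) (use t in \<open>auto simp: indicator_def\<close>)
  qed (use f in \<open>auto simp: indicator_def\<close>)
  finally show ?thesis
    using t by (simp add: field_simps)
qed

lemma diff_le_total_variation:
  fixes f :: "nat \<Rightarrow> real"
  assumes "i \<le> j" "j \<le> n"
  shows "\<bar>f j - f i\<bar> \<le> (\<Sum>a<n. \<bar>f (Suc a) - f a\<bar>)"
proof -
  have "f j - f i = (\<Sum>a=i..<j. f (Suc a) - f a)"
    using assms by (simp add: sum_Suc_diff')
  then have "\<bar>f j - f i\<bar> \<le> (\<Sum>a=i..<j. \<bar>f (Suc a) - f a\<bar>)"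
    by (metis sum_abs)
  also have "\<dots> \<le> (\<Sum>a<n. \<bar>f (Suc a) - f a\<bar>)"
    using assms by (intro sum_mono2) auto
  finally show ?thesis .
qed

section \<open>Sample positions, gaps and averages over blocks\<close>

definition config :: "nat \<Rightarrow> nat \<Rightarrow> (nat \<Rightarrow> nat) \<Rightarrow> bool" where
  "config n B s \<longleftrightarrow> strict_mono_on {..<n} s \<and> s ` {..<n} \<subseteq> {..<B}"

text \<open>The sample points cut the positions into gaps numbered \<open>0\<close> to
  \<open>n\<close>, gap \<open>g < n\<close> lying just below the sample point of rank
  \<open>g\<close>. A sample point itself lies in no gap.\<close>

definition gap_at :: "nat \<Rightarrow> (nat \<Rightarrow> nat) \<Rightarrow> nat \<Rightarrow> nat \<Rightarrow> bool" where
  "gap_at n s y g \<longleftrightarrow> g \<le> n \<and> (\<forall>k<g. s k < y) \<and> (\<forall>k. g \<le> k \<and> k < n \<longrightarrow> y < s k)"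

text \<open>What the Ramsey argument leaves of a private learner. \<open>M s\<close> is the law of
  the output on a sample with points at the positions \<open>s\<close>, and \<open>bit y\<close>
  reads the output at position \<open>y\<close>. Homogeneity concerns pairs of distinct positions
  only. Privacy is assumed for moves that keep the order of the points, with 2 in place of
  \<open>exp (1/10)\<close>.\<close>

locale homogeneous_mechanism =
  fixes M :: "(nat \<Rightarrow> nat) \<Rightarrow> 'o measure" and Out :: "'o measure"
    and bit :: "nat \<Rightarrow> 'o \<Rightarrow> bool"
    and n B :: nat and \<eta> \<delta> :: real
  assumes prob_space_M: "prob_space (M s)"
    and sets_M: "sets (M s) = sets Out"
    and bit_sets: "{h\<in>space Out. bit y h} \<in> sets Out"
    and homogeneous: "\<lbrakk>config n B s; config n B s'; y < y'; y' < B; z < z'; z' < B;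
        gap_at n s y g; gap_at n s y' g'; gap_at n s' z g; gap_at n s' z' g'\<rbrakk> \<Longrightarrow>
      \<bar>measure (M s) {h\<in>space Out. bit y h \<and> bit y' h} -
        measure (M s') {h\<in>space Out. bit z h \<and> bit z' h}\<bar> \<le> \<eta>"
    and privacy: "\<lbrakk>config n B s; a < n; config n B (s(a := v)); E \<in> sets Out\<rbrakk> \<Longrightarrow>
      measure (M s) E \<le> 2 * measure (M (s(a := v))) E + \<delta>"
    and eta_nonneg: "0 \<le> \<eta>"
begin

definition X :: "nat \<Rightarrow> 'o \<Rightarrow> real" where
  "X y \<omega> = of_bool (bit y \<omega>)"

lemma X_bounds: "0 \<le> X y \<omega>" "X y \<omega> \<le> 1" "\<bar>X y \<omega> * X z \<omega>\<bar> \<le> 1"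
  unfolding X_def by auto

definition corr :: "(nat \<Rightarrow> nat) \<Rightarrow> nat \<Rightarrow> nat \<Rightarrow> real" where
  "corr s y z = measure (M s) {h\<in>space Out. bit y h \<and> bit z h}"

lemma space_M: "space (M s) = space Out"
  using sets_M by (rule sets_eq_imp_space_eq)

lemma measurable_X [measurable]: "X y \<in> borel_measurable (M s)"
proof -
  have "Measurable.pred (M s) (bit y)"
    unfolding pred_def space_M sets_M by (rule bit_sets)
  then show ?thesis unfolding X_def by measurable
qed

lemma integrable_bounded:
  assumes "f \<in> borel_measurable (M s)" "\<And>\<omega>. \<bar>f \<omega>\<bar> \<le> (C::real)"
  shows "integrable (M s) f"
proof -
  interpret prob_space "M s" by (rule prob_space_M)
  show ?thesis
    using assms by (intro integrable_const_bound[where B = C]) auto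
qed

lemma corr_eq: "(\<integral>\<omega>. X y \<omega> * X z \<omega> \<partial>M s) = corr s y z"
proof -
  have "{h\<in>space Out. bit y h \<and> bit z h} = {h\<in>space Out. bit y h} \<inter> {h\<in>space Out. bit z h}"
    by auto
  then have *: "{h\<in>space Out. bit y h \<and> bit z h} \<in> sets (M s)"
    unfolding sets_M using bit_sets by auto
  have "(\<integral>\<omega>. X y \<omega> * X z \<omega> \<partial>M s) =
      (\<integral>\<omega>. indicator {h\<in>space Out. bit y h \<and> bit z h} \<omega> \<partial>M s)"
    by (rule Bochner_Integration.integral_cong) (auto simp: space_M X_def)
  also have "\<dots> = corr s y z"
    using * unfolding corr_def by (simp add: Int_absorb2 sets.sets_into_space)
  finally show ?thesis .
qed

lemma corr_commute: "corr s y z = corr s z y"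
  unfolding corr_def by (simp add: conj_commute)

lemma corr_bounds: "0 \<le> corr s y z" "corr s y z \<le> 1"
  unfolding corr_def using prob_space.prob_le_1[OF prob_space_M] by auto

lemma gap_at_mono:
  assumes "gap_at n s y g" "gap_at n s y' g'" "y < y'"
  shows "g \<le> g'"
proof (rule ccontr)
  assume "\<not> g \<le> g'"
  then have "s g' < y" "y' < s g'"
    using assms unfolding gap_at_def by auto
  then show False using assms(3) by simp
qed

text \<open>By \<open>gap_at_mono\<close>, the order of the two positions can differ between the
  configurations only if both gaps coincide; then the symmetry of \<open>corr\<close> allows a
  swap.\<close>

lemma corr_homogeneous:
  assumes "config n B s" "config n B s'" "y \<noteq> y'" "z \<noteq> z'" "y < B" "y' < B" "z < B" "z' < B"
    "gap_at n s y g" "gap_at n s y' g'" "gap_at n s' z g" "gap_at n s' z' g'"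
  shows "\<bar>corr s y y' - corr s' z z'\<bar> \<le> \<eta>"
proof -
  have *: "\<bar>corr s y y' - corr s' z z'\<bar> \<le> \<eta>"
    if "config n B s" "config n B s'" "y < y'" "z \<noteq> z'" "y' < B" "z < B" "z' < B"
    "gap_at n s y g" "gap_at n s y' g'" "gap_at n s' z g" "gap_at n s' z' g'" for s s' y y' z z' g g'
  proof (cases "z < z'")
    case True
    then show ?thesis
      using homogeneous[of s s' y y' z z' g g'] that unfolding corr_def by auto
  next
    case False
    then have "z' < z" using that by simp
    then have "g = g'"
      using gap_at_mono[of s y g y' g'] gap_at_mono[of s' z' g' z g] that by simp
    then show ?thesis
      using homogeneous[of s s' y y' z' z g g'] that \<open>z' < z\<close> corr_commute[of s' z z']
      unfolding corr_def by auto
  qed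
  show ?thesis
  proof (cases "y < y'")
    case True
    then show ?thesis using *[of s s' y y' z z' g g'] assms by blast
  next
    case False
    then show ?thesis
      using *[of s s' y' y z' z g' g] assms corr_commute[of s y y'] corr_commute[of s' z z'] by auto
  qed
qed

definition avg :: "nat \<Rightarrow> (nat \<Rightarrow> nat) \<Rightarrow> 'o \<Rightarrow> real" where
  "avg L p \<omega> = (\<Sum>i<L. X (p i) \<omega>) / real L"

lemma measurable_avg [measurable]: "avg L p \<in> borel_measurable (M s)"
  unfolding avg_def by measurable

lemma avg_bounds: "0 \<le> avg L p \<omega>" "avg L p \<omega> \<le> 1"
proof -
  show "0 \<le> avg L p \<omega>" unfolding avg_def by (simp add: sum_nonneg X_bounds)
  have "(\<Sum>i<L. X (p i) \<omega>) \<le> (\<Sum>i<L. 1)" by (rule sum_mono) (rule X_bounds)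
  then show "avg L p \<omega> \<le> 1" unfolding avg_def by (auto simp: divide_le_eq)
qed

lemma avg_diff_sq: "0 \<le> (avg L p \<omega> - avg L q \<omega>)\<^sup>2" "(avg L p \<omega> - avg L q \<omega>)\<^sup>2 \<le> 1"
  using avg_bounds[of L p \<omega>] avg_bounds[of L q \<omega>] by (auto simp: abs_square_le_1)

lemma avg_mult_bounded: "\<bar>avg L p \<omega> * avg L q \<omega>\<bar> \<le> 1"
  using avg_bounds[of L p \<omega>] avg_bounds[of L q \<omega>] by (simp add: mult_le_one)

lemma integrable_avg_mult: "integrable (M s) (\<lambda>\<omega>. avg L p \<omega> * avg L q \<omega>)"
  by (rule integrable_bounded[where C = 1]) (auto intro: avg_mult_bounded)

lemma integral_avg_mult:
  "(\<integral>\<omega>. avg L p \<omega> * avg L q \<omega> \<partial>M s) = (\<Sum>i<L. \<Sum>j<L. corr s (p i) (q j)) / (real L)\<^sup>2"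
proof -
  have "(\<integral>\<omega>. avg L p \<omega> * avg L q \<omega> \<partial>M s) =
      (\<integral>\<omega>. (\<Sum>i<L. \<Sum>j<L. X (p i) \<omega> * X (q j) \<omega>) / (real L)\<^sup>2 \<partial>M s)"
    unfolding avg_def by (simp add: sum_product power2_eq_square)
  also have "\<dots> = (\<integral>\<omega>. (\<Sum>i<L. \<Sum>j<L. X (p i) \<omega> * X (q j) \<omega>) \<partial>M s) / (real L)\<^sup>2"
    by simp
  also have "(\<integral>\<omega>. (\<Sum>i<L. \<Sum>j<L. X (p i) \<omega> * X (q j) \<omega>) \<partial>M s) =
      (\<Sum>i<L. \<Sum>j<L. corr s (p i) (q j))"
  proof -
    have "integrable (M s) (\<lambda>\<omega>. X (p i) \<omega> * X (q j) \<omega>)" for i j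
      by (rule integrable_bounded[where C = 1]) (auto intro: X_bounds)
    then show ?thesis
      by (simp add: corr_eq)
  qed
  finally show ?thesis .
qed

text \<open>After expanding, each off-diagonal pair costs \<eta>. On the diagonal the positions may
  coincide and homogeneity gives nothing, but these are only \<open>L\<close> of the
  \<open>L * L\<close> pairs, and they cost at most 1 each.\<close>

lemma avg_mult_homogeneous:
  assumes L: "L > 0" and s: "config n B s" "config n B s'"
    and p: "\<And>i. i < L \<Longrightarrow> p i < B \<and> gap_at n s (p i) g"
    and q: "\<And>i. i < L \<Longrightarrow> q i < B \<and> gap_at n s (q i) g'"
    and p': "\<And>i. i < L \<Longrightarrow> p' i < B \<and> gap_at n s' (p' i) g"
    and q': "\<And>i. i < L \<Longrightarrow> q' i < B \<and> gap_at n s' (q' i) g'"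
    and ne: "\<And>i j. i < L \<Longrightarrow> j < L \<Longrightarrow> i \<noteq> j \<Longrightarrow> p i \<noteq> q j \<and> p' i \<noteq> q' j"
  shows "\<bar>(\<integral>\<omega>. avg L p \<omega> * avg L q \<omega> \<partial>M s) - (\<integral>\<omega>. avg L p' \<omega> * avg L q' \<omega> \<partial>M s')\<bar> \<le> \<eta> + 1 / real L"
proof -
  let ?d = "\<lambda>i j. corr s (p i) (q j) - corr s' (p' i) (q' j)"
  have d: "\<bar>?d i j\<bar> \<le> \<eta> + of_bool (i = j)" if "i < L" "j < L" for i j
  proof (cases "i = j")
    case True
    have "\<bar>?d i j\<bar> \<le> 1"
      using corr_bounds[of s "p i" "q j"] corr_bounds[of s' "p' i" "q' j"] by linarith
    then show ?thesis using True eta_nonneg by simp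
  next
    case False
    then have "\<bar>?d i j\<bar> \<le> \<eta>"
      using that s p[of i] q[of j] p'[of i] q'[of j] ne[of i j]
      by (intro corr_homogeneous[where g = g and g' = g']) auto
    then show ?thesis using False by simp
  qed
  have "\<bar>\<Sum>i<L. \<Sum>j<L. ?d i j\<bar> \<le> (\<Sum>i<L. \<Sum>j<L. \<eta> + of_bool (i = j))"
    by (rule order.trans[OF sum_abs] sum_mono)+ (use d in auto)
  also have "\<dots> = (real L)\<^sup>2 * \<eta> + L"
    by (simp add: sum.distrib power2_eq_square algebra_simps)
  finally have *: "\<bar>\<Sum>i<L. \<Sum>j<L. ?d i j\<bar> \<le> (real L)\<^sup>2 * \<eta> + L" .
  have "(\<integral>\<omega>. avg L p \<omega> * avg L q \<omega> \<partial>M s) - (\<integral>\<omega>. avg L p' \<omega> * avg L q' \<omega> \<partial>M s')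
      = (\<Sum>i<L. \<Sum>j<L. ?d i j) / (real L)\<^sup>2"
    unfolding integral_avg_mult by (simp add: sum_subtractf diff_divide_distrib)
  then have "\<bar>(\<integral>\<omega>. avg L p \<omega> * avg L q \<omega> \<partial>M s) - (\<integral>\<omega>. avg L p' \<omega> * avg L q' \<omega> \<partial>M s')\<bar>
      \<le> ((real L)\<^sup>2 * \<eta> + L) / (real L)\<^sup>2"
    using * by (simp add: divide_right_mono)
  also have "\<dots> = \<eta> + 1 / real L"
    using L by (simp add: field_simps power2_eq_square)
  finally show ?thesis .
qed

lemma integral_avg_diff_sq:
  "(\<integral>\<omega>. (avg L p \<omega> - avg L q \<omega>)\<^sup>2 \<partial>M s) =
    (\<integral>\<omega>. avg L p \<omega> * avg L p \<omega> \<partial>M s) - 2 * (\<integral>\<omega>. avg L p \<omega> * avg L q \<omega> \<partial>M s)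
      + (\<integral>\<omega>. avg L q \<omega> * avg L q \<omega> \<partial>M s)"
proof -
  have "(\<integral>\<omega>. (avg L p \<omega> - avg L q \<omega>)\<^sup>2 \<partial>M s) =
    (\<integral>\<omega>. avg L p \<omega> * avg L p \<omega> - 2 * (avg L p \<omega> * avg L q \<omega>) + avg L q \<omega> * avg L q \<omega> \<partial>M s)"
    by (rule Bochner_Integration.integral_cong) (auto simp: power2_eq_square algebra_simps)
  then show ?thesis
    by (simp add: integrable_avg_mult)
qed

text \<open>The factor 4 is the sum of the absolute coefficients 1, 2, 1 of the three products in
  the expanded square.\<close>

lemma avg_diff_sq_homogeneous:
  assumes L: "L > 0" and s: "config n B s" "config n B s'"
    and p: "\<And>i. i < L \<Longrightarrow> p i < B \<and> gap_at n s (p i) g"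
    and q: "\<And>i. i < L \<Longrightarrow> q i < B \<and> gap_at n s (q i) g'"
    and p': "\<And>i. i < L \<Longrightarrow> p' i < B \<and> gap_at n s' (p' i) g"
    and q': "\<And>i. i < L \<Longrightarrow> q' i < B \<and> gap_at n s' (q' i) g'"
    and ne: "\<And>i j. i < L \<Longrightarrow> j < L \<Longrightarrow> i \<noteq> j \<Longrightarrow> p i \<noteq> q j \<and> p' i \<noteq> q' j"
    and inj: "inj p" "inj q" "inj p'" "inj q'"
  shows "\<bar>(\<integral>\<omega>. (avg L p \<omega> - avg L q \<omega>)\<^sup>2 \<partial>M s) - (\<integral>\<omega>. (avg L p' \<omega> - avg L q' \<omega>)\<^sup>2 \<partial>M s')\<bar>
    \<le> 4 * (\<eta> + 1 / real L)"
proof -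
  note inj = inj[THEN inj_eq]
  have aux: "\<bar>(a - 2 * c + b) - (a' - 2 * c' + b')\<bar> \<le> 4 * e"
    if "\<bar>a - a'\<bar> \<le> e" "\<bar>b - b'\<bar> \<le> e" "\<bar>c - c'\<bar> \<le> e" for a b c a' b' c' e :: real
    using that by linarith
  have "\<bar>(\<integral>\<omega>. avg L p \<omega> * avg L p \<omega> \<partial>M s) - (\<integral>\<omega>. avg L p' \<omega> * avg L p' \<omega> \<partial>M s')\<bar> \<le> \<eta> + 1 / real L"
    by (rule avg_mult_homogeneous[OF L s p p p' p']) (auto simp: inj)
  moreover have "\<bar>(\<integral>\<omega>. avg L q \<omega> * avg L q \<omega> \<partial>M s) - (\<integral>\<omega>. avg L q' \<omega> * avg L q' \<omega> \<partial>M s')\<bar> \<le> \<eta> + 1 / real L"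
    by (rule avg_mult_homogeneous[OF L s q q q' q']) (auto simp: inj)
  moreover have "\<bar>(\<integral>\<omega>. avg L p \<omega> * avg L q \<omega> \<partial>M s) - (\<integral>\<omega>. avg L p' \<omega> * avg L q' \<omega> \<partial>M s')\<bar> \<le> \<eta> + 1 / real L"
    by (rule avg_mult_homogeneous[OF L s p q p' q']) (use ne in auto)
  ultimately show ?thesis
    unfolding integral_avg_diff_sq by (rule aux)
qed

text \<open>Homogeneity cannot tell the pair of blocks \<open>p\<close>, \<open>q\<close> from the
  pair \<open>p\<close>, \<open>p\<close>, whose averages are at distance zero. So a block average
  is, up to a small mean-square error, a variable attached to the gap.\<close>

lemma avg_same_gap:
  assumes L: "L > 0" and s: "config n B s"
    and p: "\<And>i. i < L \<Longrightarrow> p i < B \<and> gap_at n s (p i) g"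
    and q: "\<And>i. i < L \<Longrightarrow> q i < B \<and> gap_at n s (q i) g"
    and ne: "\<And>i j. i < L \<Longrightarrow> j < L \<Longrightarrow> i \<noteq> j \<Longrightarrow> p i \<noteq> q j"
    and inj: "inj p" "inj q"
  shows "(\<integral>\<omega>. (avg L p \<omega> - avg L q \<omega>)\<^sup>2 \<partial>M s) \<le> 4 * (\<eta> + 1 / real L)"
proof -
  have "\<bar>(\<integral>\<omega>. (avg L p \<omega> - avg L q \<omega>)\<^sup>2 \<partial>M s) - (\<integral>\<omega>. (avg L p \<omega> - avg L p \<omega>)\<^sup>2 \<partial>M s)\<bar>
      \<le> 4 * (\<eta> + 1 / real L)"
    by (rule avg_diff_sq_homogeneous[OF L s s p q p p _ inj inj(1) inj(1)])
      (use ne inj(1)[THEN inj_eq] in auto)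
  then show ?thesis by simp
qed

text \<open>If the two gaps around the sample point number \<open>a\<close> can be told apart, then so can the
  \<open>J\<close> positions to which this point can be moved: reading the blocks from left to right, the
  first one that differs from block \<open>0\<close> tells where the point is.\<close>

lemma jump_contradiction:
  fixes base L J a :: nat and t \<kappa> \<xi> :: real
  assumes L: "L > 0" and s: "config n B s" and a: "a < n" and t: "t > 0"
    and base: "\<And>k. k < a \<Longrightarrow> s k < base"
      "\<And>k. a < k \<Longrightarrow> k < n \<Longrightarrow> base + (J + 2) * (L + 1) \<le> s k" "base + (J + 2) * (L + 1) \<le> B"
    and p: "\<And>i. i < L \<Longrightarrow> p i < B \<and> gap_at n s (p i) a"
    and q: "\<And>i. i < L \<Longrightarrow> q i < B \<and> gap_at n s (q i) (Suc a)"
    and ne: "\<And>i j. i < L \<Longrightarrow> j < L \<Longrightarrow> i \<noteq> j \<Longrightarrow> p i \<noteq> q j"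
    and inj: "inj p" "inj q"
    and \<kappa>: "\<kappa> \<le> (\<integral>\<omega>. (avg L p \<omega> - avg L q \<omega>)\<^sup>2 \<partial>M s)"
    and \<xi>: "\<xi> = 4 * (\<eta> + 1 / real L)"
  shows "J * (\<kappa> - \<xi> - t - J * \<xi> / t - \<delta>) \<le> 2"
proof -
  \<comment> \<open>Position \<open>pos j\<close> is followed by block number \<open>j\<close>,
    which fills the \<open>L\<close> places before \<open>pos (j + 1)\<close>. With the sample point
    at \<open>pos j\<close>, the blocks below \<open>j\<close> lie in gap \<open>a\<close> and the
    others in gap \<open>Suc a\<close>. \<open>pos (J + 1)\<close> serves as a common reference,
    hence the room for \<open>J + 2\<close> blocks.\<close>
  define pos where "pos j = base + j * (L + 1)" for j
  define \<beta> where "\<beta> j i = pos j + Suc i" for j i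
  define S where "S j = s(a := pos j)" for j
  have pos_mono: "pos i + (L + 1) \<le> pos j" if "i < j" for i j
  proof -
    have "Suc i * (L + 1) \<le> j * (L + 1)" using that by (intro mult_right_mono) auto
    then show ?thesis unfolding pos_def by simp
  qed
  have pos_bound: "pos j + (L + 1) \<le> base + (J + 2) * (L + 1)" if "j \<le> J + 1" for j
    using pos_mono[of j "J + 2"] that unfolding pos_def by simp
  have pos_ge: "base \<le> pos j" for j
    unfolding pos_def by simp
  have sm: "s i < s k" if "i < k" "k < n" for i k
    using s that unfolding config_def strict_mono_on_def by auto
  have sB: "s i < B" if "i < n" for i
    using s that unfolding config_def by auto
  have config_S: "config n B (S j)" if "j \<le> J + 1" for j
  proof -
    have "S j i < S j k" if "i < k" "k < n" for i k
      using that base(1)[of i] base(2)[of k] pos_bound[OF \<open>j \<le> J + 1\<close>] pos_ge[of j] sm[of i k]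
      unfolding S_def by auto
    moreover have "S j i < B" if "i < n" for i
      using that sB pos_bound[OF \<open>j \<le> J + 1\<close>] base(3) unfolding S_def by auto
    ultimately show ?thesis
      unfolding config_def strict_mono_on_def by auto
  qed
  have \<beta>_B: "\<beta> i k < base + (J + 2) * (L + 1)" if "i \<le> J + 1" "k < L" for i k
    using that pos_bound[of i] unfolding \<beta>_def by simp
  have gap_lo: "\<beta> i k < B \<and> gap_at n (S j) (\<beta> i k) a" if "i < j" "j \<le> J + 1" "k < L" for i j k
  proof -
    have y: "\<beta> i k < base + (J + 2) * (L + 1)" "base \<le> \<beta> i k" "\<beta> i k < pos j"
      using \<beta>_B[of i k] pos_ge[of i] pos_mono[of i j] that unfolding \<beta>_def by auto
    have "S j l < \<beta> i k" if "l < a" for l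
      using that base(1)[of l] y unfolding S_def by simp
    moreover have "\<beta> i k < S j l" if "a \<le> l" "l < n" for l
      using that base(2)[of l] y unfolding S_def by auto
    ultimately show ?thesis
      using a base(3) y unfolding gap_at_def by auto
  qed
  have gap_hi: "\<beta> i k < B \<and> gap_at n (S j) (\<beta> i k) (Suc a)" if "j \<le> i" "i \<le> J + 1" "k < L" for i j k
  proof -
    have "pos j \<le> pos i"
      using pos_mono[of j i] \<open>j \<le> i\<close> by (cases "i = j") auto
    then have y: "\<beta> i k < base + (J + 2) * (L + 1)" "base \<le> \<beta> i k" "pos j < \<beta> i k"
      using \<beta>_B[of i k] pos_ge[of i] that unfolding \<beta>_def by auto
    have "S j l < \<beta> i k" if "l < Suc a" for l
      using that base(1)[of l] y unfolding S_def by (auto simp: less_Suc_eq)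
    moreover have "\<beta> i k < S j l" if "Suc a \<le> l" "l < n" for l
      using that base(2)[of l] y unfolding S_def by auto
    ultimately show ?thesis
      using a base(3) y unfolding gap_at_def by auto
  qed
  have inj_\<beta>: "inj (\<beta> j)" for j
    unfolding \<beta>_def by (auto intro: injI)
  have ne_\<beta>: "\<beta> i k \<noteq> \<beta> j l" if "k < L" "l < L" "k \<noteq> l" for i j k l
    using that pos_mono[of i j] pos_mono[of j i] unfolding \<beta>_def
    by (cases i j rule: linorder_cases) auto
  define f where "f j \<omega> = (avg L (\<beta> j) \<omega> - avg L (\<beta> 0) \<omega>)\<^sup>2" for j \<omega>
  have f_meas [measurable]: "f j \<in> borel_measurable (M s)" for j s
    unfolding f_def by measurable
  have f_bounds: "0 \<le> f j \<omega>" "f j \<omega> \<le> 1" for j \<omega>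
    unfolding f_def by (rule avg_diff_sq)+
  have low: "(\<integral>\<omega>. f i \<omega> \<partial>M (S j)) \<le> \<xi>" if "i < j" "j \<le> J + 1" for i j
    unfolding f_def \<xi>
    by (rule avg_same_gap[OF L config_S gap_lo[of i j] gap_lo[of 0 j] ne_\<beta> inj_\<beta> inj_\<beta>])
      (use that in auto)
  \<comment> \<open>Block \<open>0\<close> lies below the point and block \<open>j\<close> above it,
    just as \<open>p\<close> and \<open>q\<close> do under \<open>s\<close>, so the assumed distance
    carries over up to \<xi>.\<close>
  have high: "\<kappa> - \<xi> \<le> (\<integral>\<omega>. f j \<omega> \<partial>M (S j))" if "1 \<le> j" "j \<le> J" for j
  proof -
    have "\<bar>(\<integral>\<omega>. (avg L p \<omega> - avg L q \<omega>)\<^sup>2 \<partial>M s) - (\<integral>\<omega>. (avg L (\<beta> 0) \<omega> - avg L (\<beta> j) \<omega>)\<^sup>2 \<partial>M (S j))\<bar> \<le> \<xi>"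
      unfolding \<xi>
      by (rule avg_diff_sq_homogeneous[OF L s config_S p q gap_lo[of 0 j] gap_hi[of j j]])
        (use that ne inj inj_\<beta> ne_\<beta> in simp_all)
    moreover have "(\<lambda>\<omega>. (avg L (\<beta> 0) \<omega> - avg L (\<beta> j) \<omega>)\<^sup>2) = f j"
      unfolding f_def by (auto simp: power2_commute)
    ultimately show ?thesis using \<kappa> by (simp add: abs_le_iff)
  qed
  define E where "E j = {\<omega>\<in>space Out. t \<le> f j \<omega> \<and> (\<forall>i\<in>{1..<j}. f i \<omega> < t)}" for j
  have E_sets': "E j \<in> sets (M s)" for j s
    unfolding E_def space_M[of s, symmetric] by measurable
  then have E_sets: "E j \<in> sets Out" for j
    using sets_M by auto
  \<comment> \<open>The expectation of \<open>f j\<close> forces it to reach \<open>t\<close> with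
    probability at least \<open>\<kappa> - \<xi> - t\<close>; each of the fewer than
    \<open>J\<close> earlier blocks reaches \<open>t\<close> with probability at most
    \<open>\<xi> / t\<close>.\<close>
  have E_prob: "\<kappa> - \<xi> - t - J * \<xi> / t \<le> measure (M (S j)) (E j)" if "1 \<le> j" "j \<le> J" for j
  proof -
    interpret P: prob_space "M (S j)" by (rule prob_space_M)
    let ?A = "\<lambda>i. {\<omega>\<in>space (M (S j)). t \<le> f i \<omega>}"
    have A: "?A i \<in> sets (M (S j))" for i by measurable
    have "?A j \<subseteq> E j \<union> (\<Union>i\<in>{1..<j}. ?A i)"
      unfolding E_def space_M by auto
    then have "P.prob (?A j) \<le> P.prob (E j \<union> (\<Union>i\<in>{1..<j}. ?A i))"
      using A E_sets' by (intro P.finite_measure_mono) auto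
    also have "\<dots> \<le> P.prob (E j) + P.prob (\<Union>i\<in>{1..<j}. ?A i)"
      using A E_sets' by (intro measure_Un_le) auto
    also have "P.prob (\<Union>i\<in>{1..<j}. ?A i) \<le> (\<Sum>i\<in>{1..<j}. P.prob (?A i))"
      using A by (intro measure_UNION_le) auto
    also have "\<dots> \<le> (\<Sum>i\<in>{1..<j}. \<xi> / t)"
    proof (rule sum_mono)
      fix i assume i: "i \<in> {1..<j}"
      have "P.prob (?A i) \<le> P.expectation (f i) / t"
        by (rule P.prob_threshold_le) (use f_bounds t in auto)
      also have "\<dots> \<le> \<xi> / t"
        using low[of i j] i that t by (intro divide_right_mono) auto
      finally show "P.prob (?A i) \<le> \<xi> / t" .
    qed
    also have "\<dots> \<le> J * \<xi> / t"
    proof -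
      have "0 \<le> \<xi>" unfolding \<xi> using eta_nonneg by simp
      then show ?thesis
        using that t by (auto intro!: divide_right_mono mult_right_mono)
    qed
    finally have "P.prob (?A j) \<le> P.prob (E j) + J * \<xi> / t" by simp
    moreover have "P.expectation (f j) \<le> t + P.prob (?A j)"
      by (rule P.expectation_le_threshold) (use f_bounds t in auto)
    ultimately show ?thesis
      using high[OF that] by linarith
  qed
  \<comment> \<open>One application of privacy carries each \<open>E j\<close> over to this common
    law, where the disjoint events have total probability at most 1.\<close>
  let ?R = "M (S (J + 1))"
  interpret R: prob_space ?R by (rule prob_space_M)
  have "\<kappa> - \<xi> - t - J * \<xi> / t - \<delta> \<le> 2 * measure ?R (E j)" if "1 \<le> j" "j \<le> J" for j
  proof -
    have "S (J + 1) = (S j)(a := pos (J + 1))"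
      unfolding S_def by simp
    then have "measure (M (S j)) (E j) \<le> 2 * measure ?R (E j) + \<delta>"
      using privacy[of "S j" a "pos (J + 1)" "E j"] config_S[of j] config_S[of "J + 1"] a E_sets that
      by simp
    then show ?thesis using E_prob[OF that] by linarith
  qed
  then have "(\<Sum>j\<in>{1..J}. \<kappa> - \<xi> - t - J * \<xi> / t - \<delta>) \<le> (\<Sum>j\<in>{1..J}. 2 * measure ?R (E j))"
    by (intro sum_mono) auto
  also have "\<dots> = 2 * measure ?R (\<Union>j\<in>{1..J}. E j)"
  proof -
    have "E i \<inter> E j = {}" if "1 \<le> i" "i < j" for i j
    proof (rule equals0I)
      fix \<omega> assume "\<omega> \<in> E i \<inter> E j"
      then have "t \<le> f i \<omega>" "f i \<omega> < t"
        using that unfolding E_def by auto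
      then show False by simp
    qed
    then have "disjoint_family_on E {1..J}"
      unfolding disjoint_family_on_def by (metis Int_commute atLeastAtMost_iff linorder_neqE_nat)
    then have "measure ?R (\<Union>j\<in>{1..J}. E j) = (\<Sum>j\<in>{1..J}. measure ?R (E j))"
      using E_sets' by (intro R.finite_measure_finite_Union) auto
    then show ?thesis by (simp add: sum_distrib_left)
  qed
  also have "\<dots> \<le> 2"
    using R.prob_le_1[of "\<Union>j\<in>{1..J}. E j"] by linarith
  finally show ?thesis by simp
qed

end

section \<open>Blocks of positions beside sample points on a grid\<close>

definition spaced :: "nat \<Rightarrow> nat \<Rightarrow> nat \<Rightarrow> nat \<Rightarrow> (nat \<Rightarrow> nat) \<Rightarrow> bool" where
  "spaced n B G L s \<longleftrightarrow> (\<forall>k<n. G dvd s k \<and> 0 < s k \<and> s k + L < B)"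

text \<open>The standard block of gap \<open>a\<close>, directly behind the sample point of rank
  \<open>a - 1\<close>. For the first gap, position \<open>0\<close> plays that part, which
  \<open>spaced\<close> keeps free of sample points.\<close>

definition block :: "(nat \<Rightarrow> nat) \<Rightarrow> nat \<Rightarrow> nat \<Rightarrow> nat" where
  "block s a i = (if a = 0 then 0 else s (a - 1)) + Suc i"

lemma inj_block: "inj (block s a)"
  unfolding block_def by (auto intro: injI)

lemma spaced_step:
  assumes "config n B s" "spaced n B G L s" "i < k" "k < n"
  shows "s i + G \<le> s k"
proof -
  have "s i < s k" "G dvd s k - s i"
    using assms unfolding config_def strict_mono_on_def spaced_def by auto
  then show ?thesis
    using dvd_imp_le[of G "s k - s i"] by simp
qed

lemma block_gap:
  assumes s: "config n B s" "spaced n B G L s" and "L < B" "L < G" "a \<le> n" "i < L"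
  shows "block s a i < B \<and> gap_at n s (block s a i) a"
proof
  show "block s a i < B"
    unfolding block_def using assms by (auto simp: spaced_def dest!: spec[of _ "a - 1"])
  have lo: "s k < block s a i" if "k < a" for k
  proof (cases "k = a - 1")
    case False
    then have "k < a - 1" "a - 1 < n"
      using that \<open>a \<le> n\<close> by auto
    then have "s k < s (a - 1)"
      using s(1) unfolding config_def strict_mono_on_def by auto
    then show ?thesis using that unfolding block_def by simp
  qed (use that in \<open>simp add: block_def\<close>)
  have hi: "block s a i < s k" if "a \<le> k" "k < n" for k
  proof -
    have "G \<le> s k"
      using s(2) that(2) unfolding spaced_def by (auto intro: dvd_imp_le)
    then show ?thesis
      using spaced_step[OF s, of "a - 1" k] that \<open>i < L\<close> \<open>L < G\<close> unfolding block_def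
      by (cases a) auto
  qed
  show "gap_at n s (block s a i) a"
    unfolding gap_at_def using lo hi \<open>a \<le> n\<close> by auto
qed

lemma gap_at_unique:
  assumes "gap_at n s y g" "gap_at n s y g'"
  shows "g = g'"
proof (rule ccontr)
  have *: "\<not> g < g'" if "gap_at n s y g" "gap_at n s y g'" for g g'
    using that unfolding gap_at_def by (metis less_irrefl less_le_trans order.strict_trans order_refl)
  assume "g \<noteq> g'"
  then show False using *[of g g'] *[of g' g] assms by auto
qed

lemma block_neq:
  assumes "config n B s" "spaced n B G L s" "L < B" "L < G" "a \<le> n" "b \<le> n" "i < L" "j < L" "i \<noteq> j"
  shows "block s a i \<noteq> block s b j"
proof
  assume eq: "block s a i = block s b j"
  have "gap_at n s (block s a i) a" "gap_at n s (block s b j) b"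
    using block_gap assms by blast+
  then have "a = b"
    using eq gap_at_unique by metis
  then show False
    using eq assms inj_block by (metis inj_eq)
qed

context homogeneous_mechanism
begin

text \<open>A second-moment argument. Accuracy makes \<open>Z\<close>, the test values in the upper
  half minus those in the lower half, large. Replacing each test value by the block average of its
  gap changes the second moment little, and the resulting \<open>T\<close> is at most
  \<open>K\<close> times the total variation of the block averages along the gaps. Cauchy-Schwarz
  turns this into a sum of squared jumps.\<close>

lemma accuracy_le_jumps:
  fixes G K L :: nat and \<gamma> :: real and s :: "nat \<Rightarrow> nat"
  defines "r \<equiv> block s"
  assumes L: "L > 0" "L < G" "L < B" and s: "config n B s" and K: "K > 0"
    and spaced: "spaced n B G L s"
    and d: "\<And>k. k < 2 * K \<Longrightarrow> Suc k * G < B"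
    and A: "A \<in> sets Out" "\<gamma> \<le> measure (M s) A"
      "\<And>\<omega>. \<omega> \<in> A \<Longrightarrow> K / 2 \<le> \<bar>\<Sum>k<K. X (Suc (K + k) * G) \<omega> - X (Suc k * G) \<omega>\<bar>"
  shows "\<gamma> / 4 \<le> n * (\<Sum>a<n. (\<integral>\<omega>. (avg L (r a) \<omega> - avg L (r (Suc a)) \<omega>)\<^sup>2 \<partial>M s))
    + 4 * (\<eta> + 1 / real L) + (2 + 4 * real n) / K"
proof -
  interpret P: prob_space "M s" by (rule prob_space_M)
  define pt where "pt k = Suc k * G" for k
  define v :: "nat \<Rightarrow> real" where "v k = (if k < K then - 1 else 1)" for k
  \<comment> \<open>The number of sample points below \<open>pt k\<close> is the number of its gap,
    unless \<open>pt k\<close> is itself a sample point. This can happen, as both lie on the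
    multiples of \<open>G\<close>.\<close>
  define g where "g k = card {i. i < n \<and> s i < pt k}" for k
  have sm: "s i < s k" if "i < k" "k < n" for i k
    using s that unfolding config_def strict_mono_on_def by auto
  have s_less_iff: "s i < s k \<longleftrightarrow> i < k" if "i < n" "k < n" for i k
    using sm[of i k] sm[of k i] that by (cases i k rule: linorder_cases) auto
  have g_le: "g k \<le> n" for k
    using card_mono[of "{..<n}" "{i. i < n \<and> s i < pt k}"] unfolding g_def by auto
  have g_iff: "s i < pt k \<longleftrightarrow> i < g k" if "i < n" for i k
  proof
    assume i: "s i < pt k"
    have "{..i} \<subseteq> {i. i < n \<and> s i < pt k}"
    proof
      fix j assume "j \<in> {..i}"
      then have "j < n" "s j \<le> s i"
        using that s_less_iff[of i j] by auto
      then show "j \<in> {i. i < n \<and> s i < pt k}" using i by simp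
    qed
    from card_mono[OF _ this] show "i < g k" unfolding g_def by auto
  next
    assume i: "i < g k"
    show "s i < pt k"
    proof (rule ccontr)
      assume not_less: "\<not> s i < pt k"
      have "{j. j < n \<and> s j < pt k} \<subseteq> {..<i}"
      proof
        fix j assume "j \<in> {j. j < n \<and> s j < pt k}"
        then show "j \<in> {..<i}"
          using that s_less_iff[of i j] not_less by (cases i j rule: linorder_cases) auto
      qed
      from card_mono[OF _ this] show False using i unfolding g_def by auto
    qed
  qed
  have gap_pt: "gap_at n s (pt k) (g k)" if "pt k \<notin> s ` {..<n}" for k
    unfolding gap_at_def
  proof (intro conjI allI impI g_le)
    fix i assume "i < g k"
    then show "s i < pt k" using g_iff[of i k] g_le[of k] by simp
  next
    fix i assume i: "g k \<le> i \<and> i < n"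
    then have "\<not> s i < pt k" using g_iff[of i k] by simp
    moreover have "s i \<noteq> pt k" using that i by (metis imageI lessThan_iff)
    ultimately show "pt k < s i" by simp
  qed
  have r: "r a i < B \<and> gap_at n s (r a i) a" if "a \<le> n" "i < L" for a i
    unfolding r_def by (rule block_gap[OF s spaced L(3) L(2) that])
  have r_ne: "r a i \<noteq> r b j" if "a \<le> n" "b \<le> n" "i < L" "j < L" "i \<noteq> j" for a b i j
    unfolding r_def by (rule block_neq[OF s spaced L(3) L(2) that])
  define Z where "Z \<omega> = (\<Sum>k<2*K. v k * X (pt k) \<omega>)" for \<omega>
  define T where "T \<omega> = (\<Sum>k<2*K. v k * avg L (r (g k)) \<omega>)" for \<omega>
  define V where "V \<omega> = (\<Sum>a<n. \<bar>avg L (r (Suc a)) \<omega> - avg L (r a) \<omega>\<bar>)" for \<omega>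
  have meas [measurable]: "Z \<in> borel_measurable (M s)" "T \<in> borel_measurable (M s)"
    unfolding Z_def T_def by measurable
  have split: "(\<Sum>k<2*K. v k * f k) = (\<Sum>k<K. f (K + k) - f k)" for f :: "nat \<Rightarrow> real"
  proof -
    have "(\<Sum>k<K+m. v k * f k) = (\<Sum>k<K. v k * f k) + (\<Sum>k<m. v (K + k) * f (K + k))" for m
      by (induction m) auto
    from this[of K] have "(\<Sum>k<2*K. v k * f k) = (\<Sum>k<K. v k * f k) + (\<Sum>k<K. v (K + k) * f (K + k))"
      by (simp add: mult_2)
    then show ?thesis
      unfolding v_def by (simp add: sum_subtractf sum_negf)
  qed
  have abs_v: "\<bar>v k\<bar> = 1" for k unfolding v_def by simp
  have Z2: "\<bar>(Z \<omega>)\<^sup>2\<bar> \<le> (2 * K)\<^sup>2" for \<omega>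
  proof -
    have "\<bar>Z \<omega>\<bar> \<le> (\<Sum>k<2*K. 1)"
      unfolding Z_def using X_bounds abs_v by (intro order.trans[OF sum_abs] sum_mono) (auto simp: abs_mult)
    then have "\<bar>Z \<omega>\<bar>\<^sup>2 \<le> (2 * real K)\<^sup>2"
      by (intro power_mono) auto
    then show ?thesis by simp
  qed
  have "\<gamma> * (real K)\<^sup>2 / 4 \<le> (real K)\<^sup>2 / 4 * measure (M s) A"
    using mult_left_mono[OF A(2), of "(real K)\<^sup>2 / 4"] by (simp add: mult.commute)
  also have "\<dots> = (\<integral>\<omega>. (real K)\<^sup>2 / 4 * indicator A \<omega> \<partial>M s)"
    using A(1) sets_M[of s] by (simp add: Int_absorb2 sets.sets_into_space space_M)
  also have "\<dots> \<le> (\<integral>\<omega>. (Z \<omega>)\<^sup>2 \<partial>M s)"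
  proof (rule integral_mono)
    show "integrable (M s) (\<lambda>\<omega>. (real K)\<^sup>2 / 4 * indicat_real A \<omega>)"
      using A(1) sets_M[of s]
      by (intro integrable_bounded[where C = "(real K)\<^sup>2 / 4"]) (auto simp: indicator_def)
    show "integrable (M s) (\<lambda>\<omega>. (Z \<omega>)\<^sup>2)"
      by (rule integrable_bounded[OF _ Z2]) measurable
    show "(real K)\<^sup>2 / 4 * indicat_real A \<omega> \<le> (Z \<omega>)\<^sup>2" for \<omega>
    proof (cases "\<omega> \<in> A")
      case True
      have "(real K / 2)\<^sup>2 \<le> \<bar>Z \<omega>\<bar>\<^sup>2"
        using A(3)[OF True] unfolding Z_def split pt_def by (intro power_mono) auto
      then show ?thesis using True by (simp add: power_divide)
    qed simp
  qed
  finally have lower: "\<gamma> * (real K)\<^sup>2 / 4 \<le> (\<integral>\<omega>. (Z \<omega>)\<^sup>2 \<partial>M s)" .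
  have iX: "integrable (M s) (\<lambda>\<omega>. v k * X (pt k) \<omega> * (v l * X (pt l) \<omega>))" for k l
    using X_bounds(3) abs_v by (intro integrable_bounded[where C = 1]) (auto simp: abs_mult)
  have "(\<integral>\<omega>. (Z \<omega>)\<^sup>2 \<partial>M s) = (\<Sum>k<2*K. \<Sum>l<2*K. \<integral>\<omega>. v k * X (pt k) \<omega> * (v l * X (pt l) \<omega>) \<partial>M s)"
    unfolding Z_def power2_eq_square sum_product by (simp add: iX)
  also have "\<dots> = (\<Sum>k<2*K. \<Sum>l<2*K. v k * v l * corr s (pt k) (pt l))"
  proof (intro sum.cong refl)
    fix k l
    have "(\<integral>\<omega>. v k * X (pt k) \<omega> * (v l * X (pt l) \<omega>) \<partial>M s)
      = (\<integral>\<omega>. v k * v l * (X (pt k) \<omega> * X (pt l) \<omega>) \<partial>M s)"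
      by (rule Bochner_Integration.integral_cong) auto
    then show "(\<integral>\<omega>. v k * X (pt k) \<omega> * (v l * X (pt l) \<omega>) \<partial>M s) = v k * v l * corr s (pt k) (pt l)"
      by (simp add: corr_eq)
  qed
  finally have Z_eq: "(\<integral>\<omega>. (Z \<omega>)\<^sup>2 \<partial>M s) = (\<Sum>k<2*K. \<Sum>l<2*K. v k * v l * corr s (pt k) (pt l))" .
  define c where "c k l = (\<integral>\<omega>. avg L (r (g k)) \<omega> * avg L (r (g l)) \<omega> \<partial>M s)" for k l
  have iA: "integrable (M s) (\<lambda>\<omega>. v k * avg L (r (g k)) \<omega> * (v l * avg L (r (g l)) \<omega>))" for k l
    using avg_mult_bounded abs_v by (intro integrable_bounded[where C = 1]) (auto simp: abs_mult)
  have "(\<integral>\<omega>. (T \<omega>)\<^sup>2 \<partial>M s) = (\<Sum>k<2*K. \<Sum>l<2*K. \<integral>\<omega>. v k * avg L (r (g k)) \<omega> * (v l * avg L (r (g l)) \<omega>) \<partial>M s)"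
    unfolding T_def power2_eq_square sum_product by (simp add: iA)
  also have "\<dots> = (\<Sum>k<2*K. \<Sum>l<2*K. v k * v l * c k l)"
  proof (intro sum.cong refl)
    fix k l
    have "(\<integral>\<omega>. v k * avg L (r (g k)) \<omega> * (v l * avg L (r (g l)) \<omega>) \<partial>M s)
      = (\<integral>\<omega>. v k * v l * (avg L (r (g k)) \<omega> * avg L (r (g l)) \<omega>) \<partial>M s)"
      by (rule Bochner_Integration.integral_cong) auto
    then show "(\<integral>\<omega>. v k * avg L (r (g k)) \<omega> * (v l * avg L (r (g l)) \<omega>) \<partial>M s) = v k * v l * c k l"
      by (simp add: c_def)
  qed
  finally have T_eq: "(\<integral>\<omega>. (T \<omega>)\<^sup>2 \<partial>M s) = (\<Sum>k<2*K. \<Sum>l<2*K. v k * v l * c k l)" .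
  define hit :: "nat \<Rightarrow> real" where "hit k = of_bool (pt k \<in> s ` {..<n})" for k
  define e where "e = \<eta> + 1 / real L"
  have G: "G > 0" using L by simp
  have pt_eq: "pt k = pt l \<longleftrightarrow> k = l" for k l
    unfolding pt_def using G by simp
  \<comment> \<open>The last three terms absorb the pairs with \<open>k = l\<close> or with a test
    point in the sample, where homogeneity says nothing and both quantities merely lie between 0 and
    1.\<close>
  have close: "\<bar>corr s (pt k) (pt l) - c k l\<bar> \<le> e + of_bool (k = l) + hit k + hit l"
    if "k < 2 * K" "l < 2 * K" for k l
  proof (cases "k = l \<or> pt k \<in> s ` {..<n} \<or> pt l \<in> s ` {..<n}")
    case True
    have "0 \<le> c k l" "c k l \<le> 1"
    proof -
      show "0 \<le> c k l"
        unfolding c_def by (intro Bochner_Integration.integral_nonneg mult_nonneg_nonneg avg_bounds)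
      have "c k l \<le> (\<integral>\<omega>. 1 \<partial>M s)"
        unfolding c_def using avg_mult_bounded
        by (intro integral_mono integrable_avg_mult) (auto intro: order.trans[OF abs_ge_self])
      then show "c k l \<le> 1" by (simp add: P.prob_space)
    qed
    then have "\<bar>corr s (pt k) (pt l) - c k l\<bar> \<le> 1"
      using corr_bounds[of s "pt k" "pt l"] by linarith
    moreover have "0 \<le> e" unfolding e_def using eta_nonneg by simp
    ultimately show ?thesis
      using True unfolding hit_def by auto
  next
    case False
    \<comment> \<open>A single position is treated as a constant block, which makes it comparable
      with a true block average.\<close>
    have "\<bar>(\<integral>\<omega>. avg L (\<lambda>_. pt k) \<omega> * avg L (\<lambda>_. pt l) \<omega> \<partial>M s) - c k l\<bar> \<le> e"
      unfolding c_def e_def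
    proof (rule avg_mult_homogeneous[OF L(1) s s])
      show "pt k < B \<and> gap_at n s (pt k) (g k)" "pt l < B \<and> gap_at n s (pt l) (g l)"
        using gap_pt False d that unfolding pt_def by auto
      show "pt k \<noteq> pt l \<and> r (g k) i \<noteq> r (g l) j" if "i < L" "j < L" "i \<noteq> j" for i j
        using False pt_eq r_ne[OF g_le g_le that] by auto
    qed (use r[OF g_le] in auto)
    moreover have "(\<integral>\<omega>. avg L (\<lambda>_. pt k) \<omega> * avg L (\<lambda>_. pt l) \<omega> \<partial>M s) = corr s (pt k) (pt l)"
      unfolding integral_avg_mult using L by (simp add: power2_eq_square)
    ultimately show ?thesis
      unfolding hit_def by auto
  qed
  have hits: "(\<Sum>k<2*K. hit k) \<le> n"
  proof -
    have "(\<Sum>k<2*K. hit k) = card {k\<in>{..<2*K}. pt k \<in> s ` {..<n}}"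
      unfolding hit_def by (simp add: Collect_conj_eq Int_commute lessThan_def)
    also have "card {k\<in>{..<2*K}. pt k \<in> s ` {..<n}} \<le> card (s ` {..<n})"
      by (rule card_inj_on_le[of pt]) (auto simp: inj_on_def pt_eq)
    also have "\<dots> \<le> n" using card_image_le[of "{..<n}" s] by simp
    finally show ?thesis by simp
  qed
  have "(\<integral>\<omega>. (Z \<omega>)\<^sup>2 \<partial>M s) - (\<integral>\<omega>. (T \<omega>)\<^sup>2 \<partial>M s)
      = (\<Sum>k<2*K. \<Sum>l<2*K. v k * v l * (corr s (pt k) (pt l) - c k l))"
    unfolding Z_eq T_eq by (simp add: sum_subtractf[symmetric] algebra_simps)
  also have "\<dots> \<le> (\<Sum>k<2*K. \<Sum>l<2*K. e + of_bool (k = l) + hit k + hit l)"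
  proof (intro sum_mono)
    fix k l assume kl: "k \<in> {..<2*K}" "l \<in> {..<2*K}"
    have "v k * v l * (corr s (pt k) (pt l) - c k l) \<le> \<bar>v k * v l * (corr s (pt k) (pt l) - c k l)\<bar>"
      by (rule abs_ge_self)
    also have "\<dots> = \<bar>corr s (pt k) (pt l) - c k l\<bar>"
      by (simp add: abs_mult abs_v)
    also have "\<dots> \<le> e + of_bool (k = l) + hit k + hit l"
      using close kl by simp
    finally show "v k * v l * (corr s (pt k) (pt l) - c k l) \<le> e + of_bool (k = l) + hit k + hit l" .
  qed
  also have "\<dots> = 4 * (real K)\<^sup>2 * e + 2 * K + 4 * K * (\<Sum>k<2*K. hit k)"
  proof -
    have "(\<Sum>k<2*K. \<Sum>l<2*K. hit k) = 2 * K * (\<Sum>k<2*K. hit k)"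
      by (simp add: sum_distrib_left)
    moreover have "(\<Sum>k<2*K. \<Sum>l<2*K. of_bool (k = l) :: real) = 2 * K"
      by simp
    ultimately show ?thesis
      unfolding sum.distrib by (simp add: power2_eq_square)
  qed
  also have "\<dots> \<le> 4 * (real K)\<^sup>2 * e + 2 * K + 4 * K * n"
    using hits by (simp add: mult_left_mono)
  finally have diff: "(\<integral>\<omega>. (Z \<omega>)\<^sup>2 \<partial>M s) \<le> (\<integral>\<omega>. (T \<omega>)\<^sup>2 \<partial>M s) + (4 * (real K)\<^sup>2 * e + 2 * K + 4 * K * n)"
    by simp
  have T_le: "(T \<omega>)\<^sup>2 \<le> (real K)\<^sup>2 * (n * (\<Sum>a<n. (avg L (r a) \<omega> - avg L (r (Suc a)) \<omega>)\<^sup>2))" for \<omega>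
  proof -
    \<comment> \<open>Test points \<open>k\<close> and \<open>K + k\<close> are paired; the
      difference of their block averages is at most the total variation along the gaps.\<close>
    have "\<bar>T \<omega>\<bar> \<le> (\<Sum>k<K. V \<omega>)"
      unfolding T_def split
    proof (rule order.trans[OF sum_abs], rule sum_mono)
      fix k
      have "{i. i < n \<and> s i < pt k} \<subseteq> {i. i < n \<and> s i < pt (K + k)}"
        unfolding pt_def by (auto elim!: order.strict_trans2)
      then have "g k \<le> g (K + k)"
        unfolding g_def by (intro card_mono) auto
      then show "\<bar>avg L (r (g (K + k))) \<omega> - avg L (r (g k)) \<omega>\<bar> \<le> V \<omega>"
        unfolding V_def using diff_le_total_variation[OF _ g_le, of "g k" "K + k" "\<lambda>a. avg L (r a) \<omega>"] by simp
    qed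
    then have "\<bar>T \<omega>\<bar>\<^sup>2 \<le> (K * V \<omega>)\<^sup>2"
      by (intro power_mono) auto
    also have "\<dots> = (real K)\<^sup>2 * (V \<omega>)\<^sup>2" by (simp add: power_mult_distrib)
    also have "(V \<omega>)\<^sup>2 \<le> (\<Sum>a<n. \<bar>avg L (r (Suc a)) \<omega> - avg L (r a) \<omega>\<bar>\<^sup>2) * card {..<n}"
      unfolding V_def by (rule sum_squared_le_sum_of_squares)
    also have "\<dots> = n * (\<Sum>a<n. (avg L (r a) \<omega> - avg L (r (Suc a)) \<omega>)\<^sup>2)"
      by (simp add: power2_commute)
    finally show ?thesis by (simp add: mult_left_mono)
  qed
  have iS: "integrable (M s) (\<lambda>\<omega>. (avg L (r a) \<omega> - avg L (r (Suc a)) \<omega>)\<^sup>2)" for a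
    using avg_diff_sq by (intro integrable_bounded[where C = 1]) auto
  have "(\<integral>\<omega>. (T \<omega>)\<^sup>2 \<partial>M s) \<le> (\<integral>\<omega>. (real K)\<^sup>2 * (n * (\<Sum>a<n. (avg L (r a) \<omega> - avg L (r (Suc a)) \<omega>)\<^sup>2)) \<partial>M s)"
  proof (rule integral_mono)
    show "integrable (M s) (\<lambda>\<omega>. (T \<omega>)\<^sup>2)"
      unfolding T_def power2_eq_square sum_product by (simp add: iA)
  qed (use iS T_le in auto)
  also have "\<dots> = (real K)\<^sup>2 * (n * (\<Sum>a<n. \<integral>\<omega>. (avg L (r a) \<omega> - avg L (r (Suc a)) \<omega>)\<^sup>2 \<partial>M s))"
    by (simp add: iS)
  finally have T_int: "(\<integral>\<omega>. (T \<omega>)\<^sup>2 \<partial>M s) \<le> (real K)\<^sup>2 *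
    (n * (\<Sum>a<n. \<integral>\<omega>. (avg L (r a) \<omega> - avg L (r (Suc a)) \<omega>)\<^sup>2 \<partial>M s))" (is "_ \<le> _ * ?I") .
  have "\<gamma> / 4 * (real K)\<^sup>2 \<le> (real K)\<^sup>2 * ?I + (4 * (real K)\<^sup>2 * e + 2 * K + 4 * K * n)"
    using lower diff T_int by simp
  also have "\<dots> = (?I + 4 * e + (2 + 4 * real n) / K) * (real K)\<^sup>2"
    using K by (simp add: field_simps power2_eq_square)
  finally have "\<gamma> / 4 \<le> ?I + 4 * e + (2 + 4 * real n) / K"
    using K by simp
  then show ?thesis unfolding e_def .
qed

text \<open>Accuracy with probability \<gamma> forces a mean-square jump of at least \<kappa>
  between two adjacent gaps: smaller jumps would contribute at most \<open>\<gamma> / 16\<close>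
  where \<open>\<gamma> / 8\<close> is needed. For large \<open>J\<close>,
  \<open>jump_contradiction\<close> excludes such a jump.\<close>

lemma not_accurate:
  fixes G K L J :: nat and \<gamma> \<kappa> \<xi> :: real
  assumes n: "n > 0" and L: "L > 0" "L < B" and s: "config n B s" and K: "K > 0"
    and G: "(J + 2) * (L + 1) < G"
    and spaced: "spaced n B G L s"
    and d: "\<And>k. k < 2 * K \<Longrightarrow> Suc k * G < B"
    and \<gamma>: "\<gamma> > 0" and \<kappa>: "\<kappa> = \<gamma> / (16 * (real n)\<^sup>2)"
    and \<xi>: "\<xi> = 4 * (\<eta> + 1 / real L)" "\<xi> \<le> \<gamma> / 16" "\<xi> \<le> \<kappa> / 8" "J * \<xi> \<le> \<kappa>\<^sup>2 / 32"
    and K_large: "(2 + 4 * real n) / K \<le> \<gamma> / 16"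
    and J: "8 < J * \<kappa>" and \<delta>: "\<delta> \<le> \<kappa> / 4"
    and A: "A \<in> sets Out" "\<And>\<omega>. \<omega> \<in> A \<Longrightarrow> K / 2 \<le> \<bar>\<Sum>k<K. X (Suc (K + k) * G) \<omega> - X (Suc k * G) \<omega>\<bar>"
  shows "measure (M s) A < \<gamma>"
proof (rule ccontr)
  assume "\<not> measure (M s) A < \<gamma>"
  then have A': "\<gamma> \<le> measure (M s) A" by simp
  define r where "r = block s"
  have LG: "L < G"
    using G by simp
  let ?I = "\<lambda>a. \<integral>\<omega>. (avg L (r a) \<omega> - avg L (r (Suc a)) \<omega>)\<^sup>2 \<partial>M s"
  have \<kappa>0: "\<kappa> > 0" unfolding \<kappa> using \<gamma> n by simp
  have "\<gamma> / 4 \<le> n * (\<Sum>a<n. ?I a) + \<xi> + (2 + 4 * real n) / K"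
    unfolding \<xi>(1) r_def
    by (rule accuracy_le_jumps[OF L(1) LG L(2) s K spaced d A(1) A' A(2)])
  have "\<exists>a<n. \<kappa> \<le> ?I a"
  proof (rule ccontr)
    assume "\<not> ?thesis"
    then have "(\<Sum>a<n. ?I a) \<le> (\<Sum>a<n. \<kappa>)"
      by (intro sum_mono) (auto simp: not_le)
    then have "n * (\<Sum>a<n. ?I a) \<le> n * (n * \<kappa>)"
      by (intro mult_left_mono) auto
    also have "\<dots> = \<gamma> / 16"
      unfolding \<kappa> using n by (simp add: field_simps power2_eq_square)
    finally show False
      using \<open>\<gamma> / 4 \<le> _\<close> \<xi>(2) K_large \<gamma> by linarith
  qed
  then obtain a where a: "a < n" "\<kappa> \<le> ?I a" by blast
  note step = spaced_step[OF s spaced]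
  have first: "G \<le> s k" "s k < B" if "k < n" for k
    using spaced that unfolding spaced_def by (auto intro: dvd_imp_le)
  have r_gap: "r b i < B \<and> gap_at n s (r b i) b" if "b \<le> n" "i < L" for b i
    unfolding r_def by (rule block_gap[OF s spaced L(2) LG that])
  \<comment> \<open>The level is \<open>t = \<kappa> / 4\<close>. The losses are at most
    \<open>\<kappa> / 8\<close>, \<open>\<kappa> / 4\<close>, \<open>\<kappa> / 8\<close> and
    \<open>\<kappa> / 4\<close>, so \<open>\<kappa> / 4\<close> survives, and
    \<open>J * \<kappa> / 4\<close> exceeds 2.\<close>
  have "J * (\<kappa> - \<xi> - \<kappa> / 4 - J * \<xi> / (\<kappa> / 4) - \<delta>) \<le> 2"
  proof (rule jump_contradiction[OF L(1) s a(1) _ _ _ _ _ _ _ _ _ a(2) \<xi>(1)])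
    show "\<kappa> / 4 > 0" using \<kappa>0 by simp
    \<comment> \<open>The window for the moved point starts behind \<open>s a - G\<close>, which no
      earlier sample point exceeds, and ends no later than \<open>s a\<close>.\<close>
    let ?base = "s a - G + 1"
    show "s k < ?base" if "k < a" for k
      using step[of k a] that a(1) by simp
    show "?base + (J + 2) * (L + 1) \<le> s k" if "a < k" "k < n" for k
      using step[of a k] that G first[of a] a(1) by simp
    show "?base + (J + 2) * (L + 1) \<le> B"
      using G first[of a] a(1) by simp
    show "r a i < B \<and> gap_at n s (r a i) a" "r (Suc a) i < B \<and> gap_at n s (r (Suc a) i) (Suc a)"
      if "i < L" for i
      using r_gap that a(1) by auto
    show "r a i \<noteq> r (Suc a) j" if "i < L" "j < L" "i \<noteq> j" for i j
      unfolding r_def by (rule block_neq[OF s spaced L(2) LG]) (use that a(1) in auto)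
    show "inj (r a)" "inj (r (Suc a))"
      unfolding r_def by (rule inj_block)+
  qed
  moreover have "J * \<xi> / (\<kappa> / 4) \<le> \<kappa> / 8"
    using \<xi>(4) \<kappa>0 by (simp add: field_simps power2_eq_square)
  then have "\<kappa> / 4 \<le> \<kappa> - \<xi> - \<kappa> / 4 - J * \<xi> / (\<kappa> / 4) - \<delta>"
    using \<xi>(3) \<delta> by linarith
  then have "J * (\<kappa> / 4) \<le> J * (\<kappa> - \<xi> - \<kappa> / 4 - J * \<xi> / (\<kappa> / 4) - \<delta>)"
    by (intro mult_left_mono) auto
  ultimately show False using J by linarith
qed

end

section \<open>Sampling from finitely many examples\<close>

lemma kernel_prob_space:
  assumes "space MX = UNIV" "randomized_algorithm MX MH A"
  shows "prob_space (A S T)" "sets (A S T) = sets MH"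
proof -
  let ?f = "\<lambda>i\<in>{..<length S}. S ! i" and ?g = "\<lambda>i\<in>{..<length T}. T ! i"
  have "(?f, ?g) \<in> space (sample (length S) (example_space MX) \<Otimes>\<^sub>M sample (length T) (example_space MX))"
    using assms(1) unfolding sample_def by (auto simp: space_pair_measure space_PiM PiE_iff)
  then have "A (dataset (length S) ?f) (dataset (length T) ?g) \<in> space (prob_algebra MH)"
    using assms(2) unfolding randomized_algorithm_def by (fastforce dest: measurable_space)
  moreover have "dataset (length S) ?f = S" "dataset (length T) ?g = T"
    unfolding dataset_def by (auto intro: nth_equalityI)
  ultimately show "prob_space (A S T)" "sets (A S T) = sets MH"
    by (auto simp: space_prob_algebra)
qed

abbreviation uniform :: "nat \<Rightarrow> nat measure" where
  "uniform R \<equiv> measure_pmf (pmf_of_set {..<R})"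

text \<open>Indices below \<open>K\<close> stand for informative examples, the others for the dummy.
  A union bound over the draws shows when a sample most likely consists of dummies.\<close>

lemma prob_index_hit:
  fixes m K R :: nat
  assumes "R > 0" "K \<le> R"
  shows "measure (\<Pi>\<^sub>M i\<in>{..<m}. uniform R) {T\<in>space (\<Pi>\<^sub>M i\<in>{..<m}. uniform R). \<exists>i<m. T i < K} \<le> m * K / R"
    and "{T\<in>space (\<Pi>\<^sub>M i\<in>{..<m}. uniform R). \<exists>i<m. T i < K} \<in> sets (\<Pi>\<^sub>M i\<in>{..<m}. uniform R)"
proof -
  interpret product_prob_space "\<lambda>_. uniform R" "{..<m}" by standard
  let ?Q = "\<Pi>\<^sub>M i\<in>{..<m}. uniform R"
  let ?E = "\<lambda>i. {T\<in>space ?Q. T i \<in> {..<K}}"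
  have E: "?E i \<in> sets ?Q" if "i < m" for i
    by (rule sets_Collect_single') (use that in auto)
  have U: "{T\<in>space ?Q. \<exists>i<m. T i < K} = (\<Union>i\<in>{..<m}. ?E i)" by auto
  show "{T\<in>space ?Q. \<exists>i<m. T i < K} \<in> sets ?Q"
    unfolding U by (rule sets.finite_UN[OF finite_lessThan E]) simp
  have "measure ?Q (\<Union>i\<in>{..<m}. ?E i) \<le> (\<Sum>i<m. measure ?Q (?E i))"
    using E by (intro measure_UNION_le) auto
  also have "\<dots> = (\<Sum>i<m. real K / R)"
  proof (intro sum.cong refl)
    fix i assume "i \<in> {..<m}"
    then have "emeasure ?Q (?E i) = emeasure (uniform R) {..<K}"
      by (intro emeasure_PiM_Collect_single) auto
    then have "measure ?Q (?E i) = measure (uniform R) {..<K}"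
      by (simp add: measure_def)
    also have "\<dots> = K / R"
      using assms by (subst measure_pmf_of_set) (auto simp: Int_absorb1)
    finally show "measure ?Q (?E i) = real K / R" .
  qed
  finally show "measure ?Q {T\<in>space ?Q. \<exists>i<m. T i < K} \<le> m * K / R"
    unfolding U by simp
qed

text \<open>A union bound over pairs of draws and their common value. Unlike a hit, a repeated
  informative example becomes unlikely as \<open>K\<close> grows with \<open>R / K\<close> fixed, so
  the private sample may be informative but has distinct points.\<close>

lemma prob_index_collision:
  fixes n K R :: nat
  assumes "R > 0" "K \<le> R"
  shows "measure (\<Pi>\<^sub>M i\<in>{..<n}. uniform R)
      {S\<in>space (\<Pi>\<^sub>M i\<in>{..<n}. uniform R). \<exists>i<n. \<exists>j<i. S i = S j \<and> S i < K} \<le> (real n)\<^sup>2 * K / (real R)\<^sup>2"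
    and "{S\<in>space (\<Pi>\<^sub>M i\<in>{..<n}. uniform R). \<exists>i<n. \<exists>j<i. S i = S j \<and> S i < K}
      \<in> sets (\<Pi>\<^sub>M i\<in>{..<n}. uniform R)"
proof -
  interpret product_prob_space "\<lambda>_. uniform R" "{..<n}" by standard
  let ?Q = "\<Pi>\<^sub>M i\<in>{..<n}. uniform R"
  let ?I = "{(i, j, k). i < n \<and> j < i \<and> k < K}"
  let ?E = "\<lambda>(i, j, k). {S\<in>space ?Q. \<forall>l\<in>{i, j}. S l \<in> {k}}"
  have fin: "?I \<subseteq> {..<n} \<times> {..<n} \<times> {..<K}" by auto
  then have finI: "finite ?I" using finite_subset by blast
  have E: "?E x \<in> sets ?Q" if "x \<in> ?I" for x
  proof -
    obtain i j k where x: "x = (i, j, k)" by (cases x)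
    have "{S\<in>space ?Q. S l \<in> {k}} \<in> sets ?Q" if "l < n" for l
      by (rule sets_Collect_single') (use that in auto)
    then have "{S\<in>space ?Q. S i \<in> {k}} \<inter> {S\<in>space ?Q. S j \<in> {k}} \<in> sets ?Q"
      using that x by auto
    also have "{S\<in>space ?Q. S i \<in> {k}} \<inter> {S\<in>space ?Q. S j \<in> {k}} = ?E x"
      using x by auto
    finally show ?thesis .
  qed
  have U: "{S\<in>space ?Q. \<exists>i<n. \<exists>j<i. S i = S j \<and> S i < K} = (\<Union>x\<in>?I. ?E x)"
    by auto metis
  show "{S\<in>space ?Q. \<exists>i<n. \<exists>j<i. S i = S j \<and> S i < K} \<in> sets ?Q"
    unfolding U using E finI by (intro sets.finite_UN) auto
  have "measure ?Q (\<Union>x\<in>?I. ?E x) \<le> (\<Sum>x\<in>?I. measure ?Q (?E x))"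
    using E finI by (intro measure_UNION_le) auto
  also have "\<dots> = (\<Sum>x\<in>?I. 1 / (real R)\<^sup>2)"
  proof (intro sum.cong refl)
    fix x assume "x \<in> ?I"
    then obtain i j k where x: "x = (i, j, k)" "i < n" "j < i" "k < K" by auto
    have "emeasure ?Q (?E x) = (\<Prod>l\<in>{i, j}. emeasure (uniform R) {k})"
      unfolding x(1) prod.case using x by (intro emeasure_PiM_Collect) auto
    also have "\<dots> = emeasure (uniform R) {k} * emeasure (uniform R) {k}"
      using x by simp
    finally have "measure ?Q (?E x) = measure (uniform R) {k} * measure (uniform R) {k}"
      by (simp add: measure_def enn2real_mult)
    also have "measure (uniform R) {k} = 1 / R"
    proof (subst measure_pmf_of_set)
      show "{..<R} \<noteq> {}" using assms(1) by (auto simp: lessThan_empty_iff)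
    qed (use assms x in auto)
    finally show "measure ?Q (?E x) = 1 / (real R)\<^sup>2"
      by (simp add: power2_eq_square)
  qed
  also have "\<dots> = card ?I / (real R)\<^sup>2" by simp
  also have "\<dots> \<le> (real n)\<^sup>2 * K / (real R)\<^sup>2"
  proof -
    have "card ?I \<le> n * (n * K)"
      using card_mono[OF _ fin] by (simp add: card_cartesian_product)
    then have "real (card ?I) \<le> real (n * (n * K))"
      by (rule of_nat_mono)
    then show ?thesis
      by (intro divide_right_mono) (auto simp: power2_eq_square)
  qed
  finally show "measure ?Q {S\<in>space ?Q. \<exists>i<n. \<exists>j<i. S i = S j \<and> S i < K} \<le> (real n)\<^sup>2 * K / (real R)\<^sup>2"
    unfolding U .
qed

section \<open>Running the learner on uniformly drawn indices\<close>

definition error_count :: "(nat \<Rightarrow> 'x \<times> bool) \<Rightarrow> nat \<Rightarrow> ('x \<Rightarrow> bool) \<Rightarrow> nat" where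
  "error_count z K h = card {k. k < K \<and> h (fst (z k)) \<noteq> snd (z k)}"

lemma bit_measurable:
  assumes "hypothesis_space MX MH"
  shows "{h\<in>space MH. h x} \<in> sets MH"
proof -
  have "(\<lambda>h. h x) \<in> measurable MH (count_space UNIV)"
    using assms unfolding hypothesis_space_def by blast
  from measurable_sets[OF this, of "{True}"] show ?thesis
    by (simp add: vimage_def Int_def conj_commute)
qed

lemma error_count_sets:
  assumes "hypothesis_space MX MH"
  shows "{h\<in>space MH. real (error_count z K h) \<le> c} \<in> sets MH"
proof -
  have [measurable]: "Measurable.pred MH (\<lambda>h. h x)" for x
    unfolding pred_def by (rule bit_measurable[OF assms])
  have "real (error_count z K h) = (\<Sum>k<K. of_bool (h (fst (z k)) \<noteq> snd (z k)))" for h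
    unfolding error_count_def by (simp add: Collect_conj_eq lessThan_def)
  moreover have "(\<lambda>h. (\<Sum>k<K. of_bool (h (fst (z k)) \<noteq> snd (z k)))::real) \<in> borel_measurable MH"
    by measurable
  ultimately show ?thesis
    by simp
qed

text \<open>The samples are drawn through the indices of the examples, as singletons need not be
  measurable in \<open>MX\<close>.\<close>

lemma learner_on_indexed_examples:
  fixes MX :: "'x measure" and z :: "nat \<Rightarrow> 'x \<times> bool"
  assumes MX: "space MX = UNIV" and MH: "hypothesis_space MX MH" and H: "H \<subseteq> space MH"
    and A: "randomized_algorithm MX MH A"
    and learner: "semi_private_learner_with MX MH H A n m \<alpha> \<beta> \<epsilon> \<delta>"
    and \<beta>: "\<beta> < 1" and R: "R > 0" "K \<le> R"
    and g: "g \<in> H" "\<And>k. g (fst (z k)) = snd (z k)"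
    and P: "{S\<in>space (\<Pi>\<^sub>M i\<in>{..<n}. uniform R). P S} \<in> sets (\<Pi>\<^sub>M i\<in>{..<n}. uniform R)"
    and P': "{T\<in>space (\<Pi>\<^sub>M i\<in>{..<m}. uniform R). P' T} \<in> sets (\<Pi>\<^sub>M i\<in>{..<m}. uniform R)"
    and v: "\<And>S T. \<not> P S \<Longrightarrow> \<not> P' T \<Longrightarrow>
      measure (A (map (z \<circ> S) [0..<n]) (map (z \<circ> T) [0..<m]))
        {h\<in>space MH. real (error_count z K h) \<le> \<alpha> * R} \<le> v" and v0: "0 \<le> v"
  shows "1 - \<beta> \<le> v + measure (\<Pi>\<^sub>M i\<in>{..<n}. uniform R) {S\<in>space (\<Pi>\<^sub>M i\<in>{..<n}. uniform R). P S}
     + measure (\<Pi>\<^sub>M i\<in>{..<m}. uniform R) {T\<in>space (\<Pi>\<^sub>M i\<in>{..<m}. uniform R). P' T}"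
proof -
  let ?E = "example_space MX"
  let ?q = "uniform R"
  let ?Q = "\<lambda>n. \<Pi>\<^sub>M i\<in>{..<n::nat}. ?q"
  let ?Good = "{h\<in>space MH. real (error_count z K h) \<le> \<alpha> * R}"
  define D where "D = distr ?q ?E z"
  have z_meas: "z \<in> measurable ?q ?E"
    using MX by (simp add: measurable_pmf_measure1 space_pair_measure)
  then have D: "prob_space D" "sets D = sets ?E" "space D = space ?E"
    unfolding D_def by (auto intro: measure_pmf.prob_space_distr)
  have z_D: "z \<in> measurable ?q D"
    using z_meas measurable_cong_sets[OF refl D(2)] by blast
  have prob_Q: "prob_space (?Q k)" for k
    by (intro prob_space_PiM measure_pmf.prob_space_axioms)
  have err_D: "err D h = real (error_count z R h) / R" if "h \<in> space MH" for h
  proof -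
    have h: "h \<in> measurable MX (count_space UNIV)"
      using that MH unfolding hypothesis_space_def by auto
    have "{p\<in>space ?E. h (fst p) \<noteq> snd p} \<in> sets ?E"
      using h by measurable
    then have "err D h = measure ?q (z -` {p\<in>space ?E. h (fst p) \<noteq> snd p} \<inter> space ?q)"
      unfolding err_def D_def using z_meas by (simp add: measure_distr)
    also have "z -` {p\<in>space ?E. h (fst p) \<noteq> snd p} \<inter> space ?q = {k. h (fst (z k)) \<noteq> snd (z k)}"
      using MX by (auto simp: space_pair_measure)
    also have "measure ?q \<dots> = real (error_count z R h) / R"
      using R unfolding error_count_def
      by (subst measure_pmf_of_set) (auto simp: Collect_conj_eq lessThan_def)
    finally show ?thesis .
  qed
  \<comment> \<open>\<open>g\<close> fits every example, so the infimum is at most 0 and the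
    accuracy condition bounds the error itself.\<close>
  have "err D g = 0"
    using err_D[of g] g H by (auto simp: error_count_def)
  then have Inf: "(INF h'\<in>H. err D h') \<le> 0"
    using g(1) by (intro cINF_lower2[of _ _ g]) (auto simp: err_def intro!: bdd_belowI2[where m = 0])
  \<comment> \<open>A sample from \<open>D\<close> is the image of a sample of indices, so bad
    events can be stated in terms of indices.\<close>
  have samp: "sample k D = distr (?Q k) (sample k ?E) (compose {..<k} z)"
    "compose {..<k} z \<in> measurable (?Q k) (sample k ?E)" for k
  proof -
    have "distr ?q D z = D"
      unfolding D_def by (rule distr_cong) auto
    then have "sample k D = distr (?Q k) (\<Pi>\<^sub>M i\<in>{..<k}. D) (compose {..<k} z)"
      using distr_PiM_finite_prob_space'[of "{..<k}" "\<lambda>_. ?q" "\<lambda>_. D" z] D(1) z_D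
      unfolding sample_def by (simp add: measure_pmf.prob_space_axioms)
    also have "\<dots> = distr (?Q k) (sample k ?E) (compose {..<k} z)"
      unfolding sample_def by (intro distr_cong refl sets_PiM_cong D(2))
    finally show "sample k D = distr (?Q k) (sample k ?E) (compose {..<k} z)" .
    show "compose {..<k} z \<in> measurable (?Q k) (sample k ?E)"
      unfolding sample_def compose_def using z_meas by measurable
  qed
  let ?QQ = "?Q n \<Otimes>\<^sub>M ?Q m"
  let ?SS = "sample n ?E \<Otimes>\<^sub>M sample m ?E"
  let ?c = "\<lambda>(S, T). (compose {..<n} z S, compose {..<m} z T)"
  interpret QQ: prob_space ?QQ
    by (intro prob_space_pair prob_Q)
  have "sample n D \<Otimes>\<^sub>M sample m D = distr ?QQ ?SS ?c"
    unfolding samp(1)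
  proof (rule pair_measure_distr[OF samp(2) samp(2)])
    have "prob_space (sample m D)"
      unfolding sample_def by (intro prob_space_PiM D(1))
    then show "sigma_finite_measure (distr (?Q m) (sample m ?E) (compose {..<m} z))"
      unfolding samp(1) by (rule prob_space_imp_sigma_finite)
  qed
  then have out: "output_distribution A n m D =
      distr ?QQ ?SS ?c \<bind> (\<lambda>(S, T). A (dataset n S) (dataset m T))"
    unfolding output_distribution_def by simp
  let ?k = "\<lambda>(S, T). A (dataset n S) (dataset m T)"
  have k: "?k \<in> measurable ?SS (subprob_algebra MH)"
    using A unfolding randomized_algorithm_def by (blast intro: measurable_prob_algebraD)
  have c: "?c \<in> measurable ?QQ ?SS"
    using samp(2) by measurable
  let ?kc = "\<lambda>x. ?k (?c x)"
  have kc: "?kc \<in> measurable ?QQ (subprob_algebra MH)"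
    using measurable_comp[OF c k] by (simp add: comp_def)
  have out': "output_distribution A n m D = ?QQ \<bind> ?kc"
    unfolding out by (rule bind_distr[OF c k]) (rule QQ.not_empty)
  have dist: "distribution_on ?E D"
    unfolding distribution_on_def using D by simp
  let ?acc = "{h\<in>space (output_distribution A n m D). err D h \<le> (INF h'\<in>H. err D h') + \<alpha>}"
  have "1 - \<beta> \<le> measure (output_distribution A n m D) ?acc"
    using learner dist unfolding semi_private_learner_with_def by blast
  \<comment> \<open>Each index weighs \<open>1 / R\<close>, so error \<alpha> means at most
    \<open>\<alpha> * R\<close> wrong indices, of which \<open>?Good\<close> counts only those below
    \<open>K\<close>.\<close>
  also have "\<dots> \<le> measure (output_distribution A n m D) ?Good"
  proof -
    have space_out: "space (output_distribution A n m D) = space MH"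
      unfolding out' using kc QQ.not_empty by (rule space_bind_measurable)
    have sets_out: "sets (output_distribution A n m D) = sets MH"
      unfolding out' using kc QQ.not_empty by (rule sets_bind_measurable)
    interpret out: subprob_space "output_distribution A n m D"
      unfolding out' by (rule subprob_space_bind[OF _ kc]) (rule QQ.subprob_space_axioms)
    show ?thesis
    proof (rule out.finite_measure_mono)
      show "?acc \<subseteq> ?Good"
      proof
        fix h assume "h \<in> ?acc"
        then have h: "h \<in> space MH" "err D h \<le> \<alpha>"
          using Inf space_out by auto
        then have "real (error_count z R h) \<le> \<alpha> * R"
          using err_D[of h] R by (simp add: field_simps)
        moreover have "error_count z K h \<le> error_count z R h"
          unfolding error_count_def using R by (intro card_mono) auto
        ultimately show "h \<in> ?Good" using h by auto
      qed
      show "?Good \<in> sets (output_distribution A n m D)"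
        unfolding sets_out by (rule error_count_sets[OF MH])
    qed
  qed
  also have "\<dots> = (\<integral>x. measure (?kc x) ?Good \<partial>?QQ)"
    unfolding out' by (rule QQ.measure_bind[OF kc error_count_sets[OF MH]])
  \<comment> \<open>Off the bad events the success probability is at most \<open>v\<close>; on them
    the trivial bound 1 is charged to an indicator.\<close>
  also have "\<dots> \<le> (\<integral>x. v + indicator {S\<in>space (?Q n). P S} (fst x) + indicator {T\<in>space (?Q m). P' T} (snd x) \<partial>?QQ)"
  proof (rule integral_mono)
    show "integrable ?QQ (\<lambda>x. measure (?kc x) ?Good)"
    proof (rule QQ.integrable_const_bound[where B = 1])
      show "(\<lambda>x. measure (?kc x) ?Good) \<in> borel_measurable ?QQ"
        using measurable_compose[OF kc measurable_measure_subprob_algebra[OF error_count_sets[OF MH]]] .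
      show "AE x in ?QQ. norm (measure (?kc x) ?Good) \<le> 1"
        using prob_space.prob_le_1[OF kernel_prob_space(1)[OF MX A]] by (auto simp: case_prod_beta)
    qed
    have [measurable]: "{S\<in>space (?Q n). P S} \<in> sets (?Q n)" "{T\<in>space (?Q m). P' T} \<in> sets (?Q m)"
      by (fact P P')+
    show "integrable ?QQ (\<lambda>x. v + indicat_real {S\<in>space (?Q n). P S} (fst x) + indicator {T\<in>space (?Q m). P' T} (snd x))"
      by (rule QQ.integrable_const_bound[where B = "v + 2"]) (use v0 in \<open>auto simp: indicator_def\<close>)
    fix x assume x: "x \<in> space ?QQ"
    obtain S T where ST: "x = (S, T)" by (cases x)
    have ds: "dataset k (compose {..<k} z S) = map (z \<circ> S) [0..<k]" for k S
      unfolding dataset_def by (auto simp: compose_def)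
    have "measure (A (map (z \<circ> S) [0..<n]) (map (z \<circ> T) [0..<m])) ?Good \<le> 1"
      by (rule prob_space.prob_le_1[OF kernel_prob_space(1)[OF MX A]])
    then show "measure (?kc x) ?Good \<le> v + indicator {S\<in>space (?Q n). P S} (fst x) + indicator {T\<in>space (?Q m). P' T} (snd x)"
      using v[of S T] v0 x unfolding ST by (auto simp: ds space_pair_measure indicator_def)
  qed
  also have "\<dots> = v + measure (?Q n) {S\<in>space (?Q n). P S} + measure (?Q m) {T\<in>space (?Q m). P' T}"
  proof -
    have [measurable]: "{S\<in>space (?Q n). P S} \<in> sets (?Q n)" "{T\<in>space (?Q m). P' T} \<in> sets (?Q m)"
      by (fact P P')+
    interpret Qn: prob_space "?Q n" by (rule prob_Q)
    interpret Qm: prob_space "?Q m" by (rule prob_Q)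
    have 1: "(\<integral>x. indicat_real {S\<in>space (?Q n). P S} (fst x) \<partial>?QQ) = measure (?Q n) {S\<in>space (?Q n). P S}"
    proof -
      have "(\<integral>x. indicat_real {S\<in>space (?Q n). P S} (fst x) \<partial>?QQ)
        = (\<integral>y. indicat_real {S\<in>space (?Q n). P S} y \<partial>distr ?QQ (?Q n) fst)"
        by (rule integral_distr[symmetric]) auto
      also have "distr ?QQ (?Q n) fst = ?Q n"
        by (rule Qm.distr_pair_fst)
      finally show ?thesis by (simp add: P Int_absorb2 sets.sets_into_space)
    qed
    have 2: "(\<integral>x. indicat_real {T\<in>space (?Q m). P' T} (snd x) \<partial>?QQ) = measure (?Q m) {T\<in>space (?Q m). P' T}"
    proof -
      interpret pair_prob_space "?Q n" "?Q m" ..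
      have "(\<integral>x. indicat_real {T\<in>space (?Q m). P' T} (snd x) \<partial>?QQ)
        = (\<integral>y. indicat_real {T\<in>space (?Q m). P' T} y \<partial>distr ?QQ (?Q m) snd)"
        by (rule integral_distr[symmetric]) auto
      also have "distr ?QQ (?Q m) snd = ?Q m"
      proof (rule measure_eqI)
        fix A assume "A \<in> sets (distr ?QQ (?Q m) snd)"
        then have A: "A \<in> sets (?Q m)" by simp
        have "snd -` A \<inter> space ?QQ = space (?Q n) \<times> A"
          using sets.sets_into_space[OF A] by (auto simp: space_pair_measure)
        then show "emeasure (distr ?QQ (?Q m) snd) A = emeasure (?Q m) A"
          using A by (simp add: emeasure_distr Qm.emeasure_pair_measure_Times Qn.emeasure_space_1)
      qed simp
      finally show ?thesis by (simp add: P' Int_absorb2 sets.sets_into_space)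
    qed
    have int: "integrable ?QQ (\<lambda>x. indicat_real {S\<in>space (?Q n). P S} (fst x))"
      "integrable ?QQ (\<lambda>x. indicat_real {T\<in>space (?Q m). P' T} (snd x))"
      by (rule QQ.integrable_const_bound[where B = 1]; auto simp: indicator_def)+
    show ?thesis
      by (simp add: 1 2 int QQ.prob_space)
  qed
  finally show ?thesis .
qed

section \<open>From learners to homogeneous mechanisms\<close>

text \<open>For \<open>a < b\<close>, the increasing enumeration of the numbers other than
  \<open>a\<close> and \<open>b\<close>: the ranks that sample points receive when two test points
  of ranks \<open>a\<close> and \<open>b\<close> are merged with them.\<close>

definition skip2 :: "nat \<Rightarrow> nat \<Rightarrow> nat \<Rightarrow> nat" where
  "skip2 a b k = (if k < a then k else if Suc k < b then Suc k else Suc (Suc k))"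

lemma strict_mono_on_lessThanI:
  fixes f :: "nat \<Rightarrow> nat"
  assumes "\<And>k. Suc k < n \<Longrightarrow> f k < f (Suc k)"
  shows "strict_mono_on {..<n} f"
proof -
  have "f i < f j" if "i < j" "j < n" for i j
    using that
  proof (induction j)
    case (Suc j)
    then show ?case
      using assms[of j] by (cases "i = j") auto
  qed simp
  then show ?thesis unfolding strict_mono_on_def by auto
qed

text \<open>In the merged tuple \<open>y\<close> has rank \<open>g\<close>, as \<open>g\<close>
  sample points lie below it, and \<open>y'\<close> has rank \<open>Suc g'\<close>, because
  \<open>y\<close> lies below it too.\<close>

lemma insert_two_points:
  assumes s: "config n N s" and y: "y < y'" "y' < N"
    and g: "gap_at n s y g" and g': "gap_at n s y' g'"
  obtains f where "strict_mono_on {..<n+2} f" "f ` {..<n+2} \<subseteq> {..<N}"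
    "f g = y" "f (Suc g') = y'" "\<And>k. k < n \<Longrightarrow> f (skip2 g (Suc g') k) = s k"
    "g \<le> g'" "g' \<le> n"
proof -
  have lo: "s k < y" if "k < g" for k using g that unfolding gap_at_def by auto
  have hi: "y < s k" if "g \<le> k" "k < n" for k using g that unfolding gap_at_def by auto
  have lo': "s k < y'" if "k < g'" for k using g' that unfolding gap_at_def by auto
  have hi': "y' < s k" if "g' \<le> k" "k < n" for k using g' that unfolding gap_at_def by auto
  have gn: "g \<le> n" "g' \<le> n" using g g' unfolding gap_at_def by auto
  have gg': "g \<le> g'"
  proof (rule ccontr)
    assume "\<not> g \<le> g'"
    then show False using lo[of g'] hi'[of g'] gn y by auto
  qed
  have sm: "s i < s k" if "i < k" "k < n" for i k
    using s that unfolding config_def strict_mono_on_def by auto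
  have sN: "s i < N" if "i < n" for i
    using s that unfolding config_def by auto
  define f where "f k = (if k < g then s k else if k = g then y else if k \<le> g' then s (k - 1)
    else if k = Suc g' then y' else s (k - 2))" for k
  show thesis
  proof (rule that)
    show "strict_mono_on {..<n+2} f"
    proof (rule strict_mono_on_lessThanI)
      fix k assume k: "Suc k < n + 2"
      consider "Suc k < g" | "Suc k = g" | "k = g" "k < g'" | "k = g" "k = g'" | "g < k" "k < g'"
        | "g < k" "k = g'" | "k = Suc g'" | "Suc g' < k"
        using gg' by linarith
      then show "f k < f (Suc k)"
      proof cases
        case 1
        then show ?thesis using gn sm[of k "Suc k"] by (simp add: f_def)
      next
        case 2
        then show ?thesis using lo[of k] by (simp add: f_def)
      next
        case 3
        then show ?thesis using hi[of k] gn by (simp add: f_def)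
      next
        case 4
        then show ?thesis using y by (simp add: f_def)
      next
        case 5
        then show ?thesis using sm[of "k - 1" k] gn by (simp add: f_def)
      next
        case 6
        then show ?thesis using lo'[of "k - 1"] by (simp add: f_def)
      next
        case 7
        then show ?thesis using hi'[of "k - 1"] gg' k by (simp add: f_def)
      next
        case 8
        then show ?thesis using sm[of "k - 2" "k - 1"] gg' k by (simp add: f_def)
      qed
    qed
    show "f ` {..<n+2} \<subseteq> {..<N}"
      unfolding f_def using sN y gn gg' by auto
    show "f g = y" "f (Suc g') = y'"
      using gg' by (auto simp: f_def)
    show "f (skip2 g (Suc g') k) = s k" if "k < n" for k
      using gg' unfolding f_def skip2_def by auto
  qed (use gg' gn in auto)
qed

text \<open>A pattern lists, for each entry of a private dataset, the rank of its point and its label,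
  or \<open>None\<close> for the dummy example.\<close>

type_synonym pattern = "(nat \<times> bool) option list"

definition patterns :: "nat \<Rightarrow> pattern set" where
  "patterns n = {\<sigma>. set \<sigma> \<subseteq> insert None (Some ` ({..<n} \<times> UNIV)) \<and> length \<sigma> = n}"

definition realise :: "'x \<times> bool \<Rightarrow> (nat \<Rightarrow> 'x) \<Rightarrow> pattern \<Rightarrow> ('x \<times> bool) list" where
  "realise z\<^sub>0 p \<sigma> = map (\<lambda>e. case e of None \<Rightarrow> z\<^sub>0 | Some (k, b) \<Rightarrow> (p k, b)) \<sigma>"

lemma finite_patterns: "finite (patterns n)"
  unfolding patterns_def by (rule finite_lists_length_eq) simp

lemma realise_cong:
  assumes "\<sigma> \<in> patterns n" "\<And>k. k < n \<Longrightarrow> p k = q k"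
  shows "realise z\<^sub>0 p \<sigma> = realise z\<^sub>0 q \<sigma>"
  unfolding realise_def
proof (rule map_cong[OF refl])
  fix e assume "e \<in> set \<sigma>"
  then have "e = None \<or> (\<exists>k<n. \<exists>b. e = Some (k, b))"
    using assms(1) unfolding patterns_def by auto
  then show "(case e of None \<Rightarrow> z\<^sub>0 | Some (k, b) \<Rightarrow> (p k, b)) = (case e of None \<Rightarrow> z\<^sub>0 | Some (k, b) \<Rightarrow> (q k, b))"
    using assms(2) by auto
qed

text \<open>The function that Ramsey's theorem makes nearly constant. A tuple holds a sample
  together with two test points, whose ranks are \<open>a\<close> and \<open>b\<close>; \<sigma>
  arranges the sample into a dataset. Only finitely many such triples occur, so one subsequence
  serves them all.\<close>

definition tuple_correlation ::
  "('x \<Rightarrow> bool) measure \<Rightarrow> (('x \<times> bool) list \<Rightarrow> ('x \<Rightarrow> bool) measure) \<Rightarrow> 'x \<times> bool \<Rightarrow>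
    (nat \<Rightarrow> 'x) \<Rightarrow> pattern \<times> nat \<times> nat \<Rightarrow> nat list \<Rightarrow> real" where
  "tuple_correlation MH B z\<^sub>0 u = (\<lambda>(\<sigma>, a, b) xs.
     measure (B (realise z\<^sub>0 (\<lambda>k. u (xs ! skip2 a b k)) \<sigma>)) {h\<in>space MH. h (u (xs ! a)) \<and> h (u (xs ! b))})"

lemma tuple_correlation_eq:
  assumes \<sigma>: "\<sigma> \<in> patterns n" and s: "config n N s" "y < y'" "y' < N" "gap_at n s y g" "gap_at n s y' g'"
  obtains f where "strict_mono_on {..<n+2} f" "f ` {..<n+2} \<subseteq> {..<N}" "g \<le> g'" "g' \<le> n"
    "tuple_correlation MH B z\<^sub>0 u (\<sigma>, g, Suc g') (map (w \<circ> f) [0..<n+2]) =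
      measure (B (realise z\<^sub>0 (\<lambda>k. u (w (s k))) \<sigma>)) {h\<in>space MH. h (u (w y)) \<and> h (u (w y'))}"
proof -
  obtain f where f: "strict_mono_on {..<n+2} f" "f ` {..<n+2} \<subseteq> {..<N}"
    "f g = y" "f (Suc g') = y'" "\<And>k. k < n \<Longrightarrow> f (skip2 g (Suc g') k) = s k" "g \<le> g'" "g' \<le> n"
    by (rule insert_two_points[OF s]) blast
  have nth: "map (w \<circ> f) [0..<n+2] ! k = w (f k)" if "k < n + 2" for k
    using that by (subst nth_map) (auto simp del: upt_Suc)
  have skip: "skip2 g (Suc g') k < n + 2" if "k < n" for k
    using that unfolding skip2_def by auto
  have r: "realise z\<^sub>0 (\<lambda>k. u (map (w \<circ> f) [0..<n+2] ! skip2 g (Suc g') k)) \<sigma> = realise z\<^sub>0 (\<lambda>k. u (w (s k))) \<sigma>"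
    by (rule realise_cong[OF \<sigma>]) (simp only: nth skip f(5))
  have "tuple_correlation MH B z\<^sub>0 u (\<sigma>, g, Suc g') (map (w \<circ> f) [0..<n+2]) =
      measure (B (realise z\<^sub>0 (\<lambda>k. u (w (s k))) \<sigma>)) {h\<in>space MH. h (u (w y)) \<and> h (u (w y'))}"
    unfolding tuple_correlation_def prod.case r using f(6,7) nth[of g] nth[of "Suc g'"]
    by (simp add: f(3,4) del: upt_Suc)
  with f(1,2,6,7) show thesis by (rule that)
qed

text \<open>By \<open>once\<close>, a sample point occupies at most one entry, so moving it gives a
  neighbouring dataset or the same one. In the latter case the bound is trivial since
  \<open>max \<delta> 0\<close> is nonnegative.\<close>

lemma homogeneous_mechanism_realise:
  fixes MH :: "('x \<Rightarrow> bool) measure" and u :: "nat \<Rightarrow> 'x"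
  assumes MH: "hypothesis_space MX MH"
    and B: "\<And>S. prob_space (B S)" "\<And>S. sets (B S) = sets MH"
    and dp: "differentially_private n MH (1/10) \<delta> B"
    and hom: "\<And>p f g. p \<in> patterns n \<times> {..<n+2} \<times> {..<n+2} \<Longrightarrow>
        strict_mono_on {..<n+2} f \<Longrightarrow> strict_mono_on {..<n+2} g \<Longrightarrow>
        f ` {..<n+2} \<subseteq> {..<N} \<Longrightarrow> g ` {..<n+2} \<subseteq> {..<N} \<Longrightarrow>
        \<bar>tuple_correlation MH B z\<^sub>0 u p (map (w \<circ> f) [0..<n+2]) -
          tuple_correlation MH B z\<^sub>0 u p (map (w \<circ> g) [0..<n+2])\<bar> \<le> \<eta>"
    and inj: "inj_on (u \<circ> w) {..<N}" and \<eta>: "0 \<le> \<eta>"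
    and \<sigma>: "\<sigma> \<in> patterns n"
    and once: "\<And>i j k b b'. i < n \<Longrightarrow> j < n \<Longrightarrow> \<sigma> ! i = Some (k, b) \<Longrightarrow> \<sigma> ! j = Some (k, b') \<Longrightarrow> i = j"
  shows "homogeneous_mechanism (\<lambda>s. B (realise z\<^sub>0 (\<lambda>k. u (w (s k))) \<sigma>)) MH (\<lambda>y h. h (u (w y))) n N \<eta> (max \<delta> 0)"
proof (rule homogeneous_mechanism.intro)
  let ?M = "\<lambda>s. B (realise z\<^sub>0 (\<lambda>k. u (w (s k))) \<sigma>)"
  show "prob_space (?M s)" "sets (?M s) = sets MH" for s
    by (rule B)+
  show "{h\<in>space MH. h (u (w y))} \<in> sets MH" for y
    by (rule bit_measurable[OF MH])
  show "0 \<le> \<eta>" by (rule \<eta>)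
  show "\<bar>measure (?M s) {h\<in>space MH. h (u (w y)) \<and> h (u (w y'))} -
      measure (?M s') {h\<in>space MH. h (u (w z)) \<and> h (u (w z'))}\<bar> \<le> \<eta>"
    if s: "config n N s" "config n N s'" and y: "y < y'" "y' < N" and z: "z < z'" "z' < N"
      and g: "gap_at n s y g" "gap_at n s y' g'" "gap_at n s' z g" "gap_at n s' z' g'"
    for s s' y y' z z' g g'
  proof -
    obtain f where f: "strict_mono_on {..<n+2} f" "f ` {..<n+2} \<subseteq> {..<N}" "g \<le> g'" "g' \<le> n"
      "tuple_correlation MH B z\<^sub>0 u (\<sigma>, g, Suc g') (map (w \<circ> f) [0..<n+2]) =
        measure (?M s) {h\<in>space MH. h (u (w y)) \<and> h (u (w y'))}"
      by (rule tuple_correlation_eq[OF \<sigma> s(1) y g(1,2), where MH = MH and B = B and z\<^sub>0 = z\<^sub>0 and u = u and w = w])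
        blast
    obtain f' where f': "strict_mono_on {..<n+2} f'" "f' ` {..<n+2} \<subseteq> {..<N}" "g \<le> g'" "g' \<le> n"
      "tuple_correlation MH B z\<^sub>0 u (\<sigma>, g, Suc g') (map (w \<circ> f') [0..<n+2]) =
        measure (?M s') {h\<in>space MH. h (u (w z)) \<and> h (u (w z'))}"
      by (rule tuple_correlation_eq[OF \<sigma> s(2) z g(3,4), where MH = MH and B = B and z\<^sub>0 = z\<^sub>0 and u = u and w = w])
        blast
    show ?thesis
      using hom[of "(\<sigma>, g, Suc g')" f f'] f f' \<sigma> by auto
  qed
  show "measure (?M s) E \<le> 2 * measure (?M (s(a := v))) E + max \<delta> 0"
    if s: "config n N s" "a < n" "config n N (s(a := v))" and E: "E \<in> sets MH" for s a v E
  proof -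
    let ?S = "realise z\<^sub>0 (\<lambda>k. u (w (s k))) \<sigma>" and ?S' = "realise z\<^sub>0 (\<lambda>k. u (w ((s(a := v)) k))) \<sigma>"
    have len: "length \<sigma> = n" using \<sigma> unfolding patterns_def by simp
    have nth: "realise z\<^sub>0 p \<sigma> ! i = (case \<sigma> ! i of None \<Rightarrow> z\<^sub>0 | Some (k, b) \<Rightarrow> (p k, b))" if "i < n" for i p
      using that len unfolding realise_def by simp
    have lenS: "length ?S = n" "length ?S' = n"
      using len unfolding realise_def by auto
    show ?thesis
    proof (cases "?S = ?S'")
      case True
      then show ?thesis by simp
    next
      case False
      have diff: "\<exists>b. \<sigma> ! i = Some (a, b)" if "i < n" "?S ! i \<noteq> ?S' ! i" for i
        using that by (auto simp: nth split: option.splits if_splits)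
      obtain i where i: "i < n" "?S ! i \<noteq> ?S' ! i"
        using False lenS nth_equalityI by metis
      have uniq: "j = i" if "j < n" "?S ! j \<noteq> ?S' ! j" for j
        using diff[OF i] diff[OF that] once i that by blast
      have "neighbouring ?S ?S'"
        unfolding neighbouring_def lenS
      proof (intro conjI refl, rule ex1I[of _ i])
        show "i < n \<and> ?S ! i \<noteq> ?S' ! i" using i by blast
        show "j = i" if "j < n \<and> ?S ! j \<noteq> ?S' ! j" for j
          using uniq that by blast
      qed
      then have "measure (B ?S) E \<le> exp (1/10) * measure (B ?S') E + \<delta>"
        using dp lenS E unfolding differentially_private_def by blast
      moreover have "exp (1/10 :: real) \<le> 2"
        using exp_bound[of "1/10"] by (simp add: power2_eq_square)
      then have "exp (1/10) * measure (B ?S') E \<le> 2 * measure (B ?S') E"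
        by (intro mult_right_mono) auto
      ultimately show ?thesis by linarith
    qed
  qed
qed

section \<open>Drawn private samples as spaced configurations\<close>

lemma strict_mono_enumeration:
  fixes I :: "nat set"
  assumes "finite I"
  obtains e where "strict_mono_on {..<card I} e" "e ` {..<card I} = I"
proof
  let ?e = "\<lambda>k. sorted_list_of_set I ! k"
  have len: "length (sorted_list_of_set I) = card I"
    using assms by simp
  show "strict_mono_on {..<card I} ?e"
    unfolding strict_mono_on_def using assms len by (auto simp: sorted_wrt_nth_less)
  show "?e ` {..<card I} = I"
    using assms len by (metis list.set_map map_nth set_sorted_list_of_set set_upt atLeast_upt)
qed

text \<open>A sample may use fewer than \<open>n\<close> positions, while a configuration has
  \<open>n\<close> points. The missing ones are grid positions beyond the examples, to which no
  entry of \<sigma> refers. The length \<open>(K + n + 1) * G\<close> covers the examples, up to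
  \<open>n\<close> such fillers and the block behind the last point.\<close>

lemma sample_as_pattern:
  fixes S :: "nat \<Rightarrow> nat" and z :: "nat \<Rightarrow> 'x \<times> bool"
  assumes distinct: "\<And>i j. i < n \<Longrightarrow> j < n \<Longrightarrow> S i = S j \<Longrightarrow> S i < K \<Longrightarrow> i = j"
    and z: "\<And>k. k < K \<Longrightarrow> z k = (x (Suc k * G), lab k)" "\<And>k. K \<le> k \<Longrightarrow> z k = z\<^sub>0"
    and G: "L < G"
  obtains \<sigma> s where "\<sigma> \<in> patterns n" "config n ((K + n + 1) * G) s" "spaced n ((K + n + 1) * G) G L s"
    "map (z \<circ> S) [0..<n] = realise z\<^sub>0 (\<lambda>k. x (s k)) \<sigma>"
    "\<And>i j k b b'. i < n \<Longrightarrow> j < n \<Longrightarrow> \<sigma> ! i = Some (k, b) \<Longrightarrow> \<sigma> ! j = Some (k, b') \<Longrightarrow> i = j"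
proof -
  define I where "I = {k. k < K \<and> k \<in> S ` {..<n}}"
  have "card I \<le> card (S ` {..<n})"
    unfolding I_def by (intro card_mono) auto
  also have "\<dots> \<le> n" using card_image_le[of "{..<n}" S] by simp
  finally have card_I: "card I \<le> n" .
  define I' where "I' = I \<union> {K..<K + (n - card I)}"
  have finI': "finite I'" unfolding I'_def I_def by auto
  have "card I' = card I + card {K..<K + (n - card I)}"
    unfolding I'_def by (rule card_Un_disjoint) (auto simp: I_def)
  then have card_I': "card I' = n" using card_I by simp
  obtain e where e: "strict_mono_on {..<n} e" "e ` {..<n} = I'"
    using strict_mono_enumeration[OF finI'] unfolding card_I' .
  have e_bound: "e k < K + n" if "k < n" for k
  proof -
    have "e k \<in> I'" using e(2) that by blast
    then show ?thesis unfolding I'_def I_def by auto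
  qed
  have e_inj: "inj_on e {..<n}"
    using e(1) by (rule strict_mono_on_imp_inj_on)
  define rank where "rank = the_inv_into {..<n} e"
  have rank: "rank k < n" "e (rank k) = k" if "k \<in> I" for k
  proof -
    have "k \<in> e ` {..<n}" using that e(2) unfolding I'_def by simp
    then show "rank k < n" "e (rank k) = k"
      unfolding rank_def using the_inv_into_into[OF e_inj _ order_refl] f_the_inv_into_f[OF e_inj] by auto
  qed
  define s where "s k = Suc (e k) * G" for k
  define \<sigma> where "\<sigma> = map (\<lambda>i. if S i < K then Some (rank (S i), lab (S i)) else None) [0..<n]"
  have SI: "S i \<in> I" if "i < n" "S i < K" for i
    using that unfolding I_def by auto
  have G0: "0 < G" using G by simp
  show thesis
  proof (rule that)
    show "\<sigma> \<in> patterns n"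
      unfolding patterns_def \<sigma>_def using rank(1) SI by auto
    have bound: "s k + G \<le> (K + n + 1) * G" if "k < n" for k
    proof -
      have "(Suc (e k) + 1) * G \<le> (K + n + 1) * G"
        using e_bound[OF that] by (intro mult_right_mono) auto
      then show ?thesis unfolding s_def by (simp add: algebra_simps)
    qed
    show "config n ((K + n + 1) * G) s"
      unfolding config_def
    proof
      show "strict_mono_on {..<n} s"
        using e(1) G0 unfolding strict_mono_on_def s_def by (auto intro!: mult_strict_right_mono simp del: mult_Suc)
      show "s ` {..<n} \<subseteq> {..<(K + n + 1) * G}"
      proof
        fix y assume "y \<in> s ` {..<n}"
        then obtain k where "k < n" "y = s k" by auto
        then show "y \<in> {..<(K + n + 1) * G}" using bound[of k] G0 by simp
      qed
    qed
    show "spaced n ((K + n + 1) * G) G L s"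
      unfolding spaced_def
    proof (intro allI impI conjI)
      fix k assume "k < n"
      show "G dvd s k" "0 < s k" unfolding s_def using G0 by auto
      show "s k + L < (K + n + 1) * G" using bound[OF \<open>k < n\<close>] G by linarith
    qed
    show "map (z \<circ> S) [0..<n] = realise z\<^sub>0 (\<lambda>k. x (s k)) \<sigma>"
      unfolding realise_def \<sigma>_def map_map
      by (rule map_cong[OF refl]) (use rank(2) SI z in \<open>auto simp: s_def not_less\<close>)
    show "i = j" if "i < n" "j < n" "\<sigma> ! i = Some (k, b)" "\<sigma> ! j = Some (k, b')" for i j k b b'
    proof -
      have "S i < K" "S j < K" "rank (S i) = k" "rank (S j) = k"
        using that unfolding \<sigma>_def by (auto split: if_splits)
      then have "S i = S j" using rank(2) SI that by metis
      then show ?thesis using distinct that \<open>S i < K\<close> by blast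
    qed
  qed
qed

section \<open>The lower bound\<close>

lemma threshold_seqD:
  assumes "threshold_seq c UNIV H k u h" "i < k"
  shows "h i \<in> H" "j < k \<Longrightarrow> h i (u j) = ((i \<le> j) = c)"
  using assms unfolding threshold_seq_def by auto

lemma threshold_seq_inj:
  assumes "threshold_seq c UNIV H k u h"
  shows "inj_on u {..<k}"
proof -
  have *: "u i \<noteq> u j" if "i < j" "j < k" for i j
  proof
    assume "u i = u j"
    then have "((j \<le> i) = c) = ((j \<le> j) = c)"
      using threshold_seqD(2)[OF assms, of j i] threshold_seqD(2)[OF assms, of j j] that by simp
    then show False using that by auto
  qed
  show ?thesis
  proof (rule inj_onI)
    fix i j assume "i \<in> {..<k}" "j \<in> {..<k}" "u i = u j"
    then show "i = j" using *[of i j] *[of j i] by (cases i j rule: linorder_cases) auto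
  qed
qed

text \<open>Both samples most likely consist of dummies, so one output law has to serve
  \<open>k\<close> thresholds. Each success event has probability at least
  \<open>(1 - \<beta>) / 2\<close>, but the events are disjoint because less than one error is
  allowed.\<close>

lemma no_learner_with_small_samples:
  fixes MX :: "'x measure" and n m k \<rho> :: nat and \<alpha> \<beta> \<epsilon> \<delta> :: real
  assumes MX: "space MX = UNIV" and MH: "hypothesis_space MX MH" and H: "H \<subseteq> space MH"
    and Ldim: "littlestone_dim H = \<infinity>" and A: "randomized_algorithm MX MH A"
    and learner: "semi_private_learner_with MX MH H A n m \<alpha> \<beta> \<epsilon> \<delta>"
    and \<beta>: "\<beta> < 1" and \<rho>: "\<rho> > 0" "n / \<rho> \<le> (1 - \<beta>) / 4" "m / \<rho> \<le> (1 - \<beta>) / 4"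
    and k: "2 < k * (1 - \<beta>)" and \<alpha>: "\<alpha> * \<rho> * k < 1"
  shows False
proof -
  have k0: "k > 0" using k by (cases k) auto
  \<comment> \<open>The extra point \<open>u k\<close> supplies the dummy: every \<open>h t\<close>
    with \<open>t < k\<close> has the value \<open>c\<close> there, so the dummy reveals nothing
    about \<open>t\<close>.\<close>
  obtain c u h where th: "threshold_seq c UNIV H (Suc k) u h"
    by (rule infinite_littlestone_thresholds[OF Ldim])
  define z\<^sub>0 where "z\<^sub>0 = (u k, c)"
  define z where "z t j = (if j < k then (u j, (t \<le> j) = c) else z\<^sub>0)" for t j
  define R where "R = k * \<rho>"
  have R: "R > 0" "k \<le> R" unfolding R_def using k0 \<rho> by auto
  define Good where "Good t = {g\<in>space MH. real (error_count (z t) k g) \<le> \<alpha> * R}" for t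
  define \<mu> where "\<mu> = A (replicate n z\<^sub>0) (replicate m z\<^sub>0)"
  interpret \<mu>: prob_space \<mu>
    unfolding \<mu>_def by (rule kernel_prob_space[OF MX A])
  have sets_\<mu>: "sets \<mu> = sets MH"
    unfolding \<mu>_def by (rule kernel_prob_space[OF MX A])
  have Good_sets: "Good t \<in> sets \<mu>" for t
    unfolding sets_\<mu> Good_def by (rule error_count_sets[OF MH])
  have hit: "j * k / R = j / \<rho>" for j
    unfolding R_def using k0 by simp
  have Good_prob: "(1 - \<beta>) / 2 \<le> \<mu>.prob (Good t)" if "t < k" for t
  proof -
    have "1 - \<beta> \<le> \<mu>.prob (Good t)
      + measure (\<Pi>\<^sub>M i\<in>{..<n}. uniform R) {S\<in>space (\<Pi>\<^sub>M i\<in>{..<n}. uniform R). \<exists>i<n. S i < k}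
      + measure (\<Pi>\<^sub>M i\<in>{..<m}. uniform R) {T\<in>space (\<Pi>\<^sub>M i\<in>{..<m}. uniform R). \<exists>i<m. T i < k}"
    proof (rule learner_on_indexed_examples[OF MX MH H A learner \<beta> R, where g = "h t" and z = "z t"])
      show "h t \<in> H" using threshold_seqD(1)[OF th, of t] that by simp
      show "h t (fst (z t j)) = snd (z t j)" for j
        using threshold_seqD(2)[OF th, of t j] threshold_seqD(2)[OF th, of t k] that
        unfolding z_def z\<^sub>0_def by auto
      fix S T :: "nat \<Rightarrow> nat"
      assume "\<not> (\<exists>i<n. S i < k)" "\<not> (\<exists>i<m. T i < k)"
      then have "map (z t \<circ> S) [0..<n] = replicate n z\<^sub>0" "map (z t \<circ> T) [0..<m] = replicate m z\<^sub>0"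
        by (auto simp: z_def map_replicate_const[symmetric] intro!: replicate_eqI)
      then show "measure (A (map (z t \<circ> S) [0..<n]) (map (z t \<circ> T) [0..<m]))
          {g\<in>space MH. real (error_count (z t) k g) \<le> \<alpha> * R} \<le> \<mu>.prob (Good t)"
        unfolding \<mu>_def Good_def by simp
    qed (use prob_index_hit(2)[OF R] in auto)
    moreover have "x \<ge> (1 - \<beta>) / 2" if "1 - \<beta> \<le> x + y + y'" "y \<le> n / \<rho>" "y' \<le> m / \<rho>" for x y y' :: real
      using that(1) order.trans[OF that(2) \<rho>(2)] order.trans[OF that(3) \<rho>(3)] by simp
    ultimately show ?thesis
      using prob_index_hit(1)[OF R, of n] prob_index_hit(1)[OF R, of m] unfolding hit by blast
  qed
  have "disjoint_family_on Good {..<k}"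
  proof -
    have no_error: "g (u j) = ((t \<le> j) = c)" if "g \<in> Good t" "j < k" for g t j
    proof (rule ccontr)
      assume "g (u j) \<noteq> ((t \<le> j) = c)"
      then have "j \<in> {j. j < k \<and> g (fst (z t j)) \<noteq> snd (z t j)}"
        using that unfolding z_def by auto
      then have "error_count (z t) k g > 0"
        unfolding error_count_def by (auto simp: card_gt_0_iff)
      then have "1 \<le> real (error_count (z t) k g)" by simp
      also have "\<dots> \<le> \<alpha> * R" using that unfolding Good_def by simp
      finally have "1 \<le> \<alpha> * R" .
      then show False using \<alpha> unfolding R_def by (simp add: mult_ac)
    qed
    have *: "Good s \<inter> Good t = {}" if "s < t" "t < k" for s t
    proof (rule equals0I)
      fix g assume "g \<in> Good s \<inter> Good t"
      then have "((s \<le> s) = c) = ((t \<le> s) = c)"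
        using no_error[of g s s] no_error[of g t s] that by auto
      then show False using that by auto
    qed
    then show ?thesis
      unfolding disjoint_family_on_def by (metis Int_commute lessThan_iff linorder_neqE_nat)
  qed
  then have "\<mu>.prob (\<Union>t\<in>{..<k}. Good t) = (\<Sum>t<k. \<mu>.prob (Good t))"
    using Good_sets by (intro \<mu>.finite_measure_finite_Union) auto
  then have "(\<Sum>t<k. (1 - \<beta>) / 2) \<le> 1"
    using sum_mono[of "{..<k}" "\<lambda>_. (1 - \<beta>) / 2" "\<lambda>t. \<mu>.prob (Good t)"] Good_prob
      \<mu>.prob_le_1[of "\<Union>t\<in>{..<k}. Good t"] by simp
  then show False using k by simp
qed

text \<open>The success probability should be \<open>1 - \<beta> = 4 * \<gamma>\<close>. A public
  hit and a private collision have probability at most \<gamma> each, and outside these events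
  \<open>not_accurate\<close> bounds the success by \<gamma>.\<close>

lemma no_learner_with_negligible_delta:
  fixes MX :: "'x measure" and n m \<rho> :: nat and \<alpha> \<beta> \<delta> :: real
  assumes MX: "space MX = UNIV" and MH: "hypothesis_space MX MH" and H: "H \<subseteq> space MH"
    and Ldim: "littlestone_dim H = \<infinity>" and A: "randomized_algorithm MX MH A"
    and learner: "semi_private_learner_with MX MH H A n m \<alpha> \<beta> (1/10) \<delta>"
    and \<beta>: "\<beta> < 1" and n: "n > 0" and \<rho>: "\<rho> > 0" "m / \<rho> \<le> (1 - \<beta>) / 4"
    and \<alpha>: "\<alpha> * \<rho> \<le> 1 / 4" and \<delta>: "\<delta> \<le> (1 - \<beta>) / (256 * (real n)\<^sup>2)"
  shows False
proof -
  define \<gamma> where "\<gamma> = (1 - \<beta>) / 4"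
  define \<kappa> where "\<kappa> = \<gamma> / (16 * (real n)\<^sup>2)"
  have \<gamma>: "\<gamma> > 0" unfolding \<gamma>_def using \<beta> by simp
  have \<kappa>: "\<kappa> > 0" unfolding \<kappa>_def using \<gamma> n by simp
  \<comment> \<open>The constants are fixed in the order \<open>J\<close>, \<open>L\<close>,
    \<open>K\<close>, \<open>G\<close>, \<open>N\<close>, each from \<beta>, \<open>n\<close> and
    earlier ones, to meet the demands of \<open>not_accurate\<close>; the Ramsey number
    \<open>M\<close> comes last.\<close>
  obtain J :: nat where J: "8 / \<kappa> < J" using reals_Archimedean2 by blast
  have J0: "J > 0" using J \<kappa> by (cases J) (auto simp: divide_less_0_iff not_less)
  define \<xi>\<^sub>0 where "\<xi>\<^sub>0 = min (\<gamma> / 16) (min (\<kappa> / 8) (\<kappa>\<^sup>2 / (32 * J)))"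
  have \<xi>\<^sub>0: "\<xi>\<^sub>0 > 0" unfolding \<xi>\<^sub>0_def using \<gamma> \<kappa> J0 by simp
  define \<eta> where "\<eta> = \<xi>\<^sub>0 / 8"
  have \<eta>: "\<eta> > 0" unfolding \<eta>_def using \<xi>\<^sub>0 by simp
  obtain L :: nat where L: "8 / \<xi>\<^sub>0 < L" using reals_Archimedean2 by blast
  have L0: "L > 0" using L \<xi>\<^sub>0 by (cases L) (auto simp: divide_less_0_iff not_less)
  define \<xi> where "\<xi> = 4 * (\<eta> + 1 / real L)"
  have "1 / real L < \<xi>\<^sub>0 / 8"
    using L \<xi>\<^sub>0 L0 by (simp add: field_simps)
  then have "\<xi> \<le> \<xi>\<^sub>0" unfolding \<xi>_def \<eta>_def by simp
  then have \<xi>: "\<xi> \<le> \<gamma> / 16" "\<xi> \<le> \<kappa> / 8" "\<xi> \<le> \<kappa>\<^sup>2 / (32 * J)"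
    unfolding \<xi>\<^sub>0_def by auto
  obtain K :: nat where K: "max ((real n)\<^sup>2 / \<gamma>) (16 * (2 + 4 * real n) / \<gamma>) < K"
    using reals_Archimedean2 by blast
  have "0 \<le> (real n)\<^sup>2 / \<gamma>" using \<gamma> by simp
  then have K0: "K > 0" using K by (cases K) auto
  have K1: "(2 + 4 * real n) / K \<le> \<gamma> / 16" "(real n)\<^sup>2 / K \<le> \<gamma>"
    using K \<gamma> K0 by (auto simp: field_simps)
  \<comment> \<open>\<open>G\<close> exceeds the window needed to move a sample point;
    \<open>N\<close> has room for \<open>2 * K\<close> grid examples and the fillers of
    \<open>sample_as_pattern\<close>.\<close>
  define G where "G = (J + 2) * (L + 1) + 1"
  define N where "N = (2 * K + n + 1) * G"
  have LG: "L < G" unfolding G_def by simp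
  have G0: "G > 0" unfolding G_def by simp
  have "G \<le> N" unfolding N_def by simp
  then have LN: "L < N" using LG by simp
  have fin: "finite (patterns n \<times> {..<n+2} \<times> {..<n+2})"
    using finite_patterns by blast
  obtain M where M: "\<And>F :: pattern \<times> nat \<times> nat \<Rightarrow> nat list \<Rightarrow> real. (\<And>p xs. 0 \<le> F p xs \<and> F p xs \<le> 1) \<Longrightarrow>
    (\<exists>w. strict_mono_on {..<N} w \<and> w ` {..<N} \<subseteq> {..<M} \<and>
      (\<forall>p\<in>patterns n \<times> {..<n+2} \<times> {..<n+2}. \<forall>f g. strict_mono_on {..<n+2} f \<longrightarrow> strict_mono_on {..<n+2} g \<longrightarrow>
         f ` {..<n+2} \<subseteq> {..<N} \<longrightarrow> g ` {..<n+2} \<subseteq> {..<N} \<longrightarrow>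
         \<bar>F p (map (w \<circ> f) [0..<n+2]) - F p (map (w \<circ> g) [0..<n+2])\<bar> \<le> \<eta>))"
    using ramsey_approx[OF fin \<eta>, of N "n+2"] by blast
  \<comment> \<open>The subsequence stays below \<open>M\<close>, so \<open>u M\<close> is free for
    the dummy, and every \<open>h t\<close> with \<open>t < M\<close> has the value \<open>c\<close>
    there.\<close>
  obtain c u h where th: "threshold_seq c UNIV H (Suc M) u h"
    by (rule infinite_littlestone_thresholds[OF Ldim])
  define z\<^sub>0 where "z\<^sub>0 = (u M, c)"
  \<comment> \<open>The public sample is frozen to dummies, which leaves a differentially private
    mechanism without public data.\<close>
  define B where "B S = A S (replicate m z\<^sub>0)" for S
  have B: "prob_space (B S)" "sets (B S) = sets MH" for S
    unfolding B_def by (rule kernel_prob_space[OF MX A])+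
  have dp: "differentially_private n MH (1/10) \<delta> B"
    using learner unfolding semi_private_learner_with_def B_def by simp
  have "0 \<le> tuple_correlation MH B z\<^sub>0 u p xs \<and> tuple_correlation MH B z\<^sub>0 u p xs \<le> 1" for p xs
    unfolding tuple_correlation_def using prob_space.prob_le_1[OF B(1)]
    by (auto simp: case_prod_beta)
  from M[where F = "tuple_correlation MH B z\<^sub>0 u", OF this] obtain w where w: "strict_mono_on {..<N} w" "w ` {..<N} \<subseteq> {..<M}"
    and hom: "\<forall>p\<in>patterns n \<times> {..<n+2} \<times> {..<n+2}. \<forall>f g.
        strict_mono_on {..<n+2} f \<longrightarrow> strict_mono_on {..<n+2} g \<longrightarrow>
        f ` {..<n+2} \<subseteq> {..<N} \<longrightarrow> g ` {..<n+2} \<subseteq> {..<N} \<longrightarrow>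
        \<bar>tuple_correlation MH B z\<^sub>0 u p (map (w \<circ> f) [0..<n+2]) -
          tuple_correlation MH B z\<^sub>0 u p (map (w \<circ> g) [0..<n+2])\<bar> \<le> \<eta>"
    by (elim exE conjE) (rule that)
  have inj: "inj_on (u \<circ> w) {..<N}"
  proof (rule comp_inj_on)
    show "inj_on w {..<N}" using w(1) by (rule strict_mono_on_imp_inj_on)
    have "w ` {..<N} \<subseteq> {..<Suc M}" using w(2) by auto
    then show "inj_on u (w ` {..<N})" by (rule inj_on_subset[OF threshold_seq_inj[OF th]])
  qed
  have pt_N: "Suc k * G < N" if "k < 2 * K" for k
  proof -
    have "Suc k * G < (2 * K + n + 1) * G"
      using that G0 by (intro mult_strict_right_mono) auto
    then show ?thesis unfolding N_def .
  qed
  \<comment> \<open>The target threshold starts at example number \<open>K\<close>: the first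
    \<open>K\<close> labels are opposite to \<open>c\<close>, the last \<open>K\<close> are equal to
    \<open>c\<close>.\<close>
  define z where "z k = (if k < 2 * K then (u (w (Suc k * G)), (K \<le> k) = c) else z\<^sub>0)" for k
  define R where "R = 2 * K * \<rho>"
  have R: "R > 0" "2 * K \<le> R" unfolding R_def using K0 \<rho> by auto
  define Good where "Good = {g\<in>space MH. real (error_count z (2 * K) g) \<le> \<alpha> * R}"
  define t where "t = w (Suc K * G)"
  have t: "t < M" unfolding t_def using pt_N[of K] K0 w(2) by auto
  have label: "h t (u (w (Suc k * G))) = ((K \<le> k) = c)" if "k < 2 * K" for k
  proof -
    have kN: "Suc k * G < N" "Suc K * G < N" using pt_N[of k] pt_N[of K] that K0 by auto
    have "t \<le> w (Suc k * G) \<longleftrightarrow> Suc K * G \<le> Suc k * G"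
      unfolding t_def using w(1) kN by (intro strict_mono_on_less_eq) auto
    also have "\<dots> \<longleftrightarrow> K \<le> k" using G0 by (simp del: mult_Suc)
    finally show ?thesis
      using threshold_seqD(2)[OF th, of t "w (Suc k * G)"] t w(2) kN by (auto simp: less_Suc_eq)
  qed
  \<comment> \<open>Up to a common sign, the pair \<open>k\<close>, \<open>K + k\<close> contributes
    1 minus its number of errors, and at most \<open>\<alpha> * R \<le> K / 2\<close> errors occur
    in total.\<close>
  have Good_large: "K / 2 \<le> \<bar>\<Sum>k<K. of_bool (g (u (w (Suc (K + k) * G)))) - of_bool (g (u (w (Suc k * G))))\<bar>"
    if "g \<in> Good" for g
  proof -
    define e :: "nat \<Rightarrow> real" where "e k = of_bool (g (fst (z k)) \<noteq> snd (z k))" for k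
    have "real (error_count z (2 * K) g) = (\<Sum>k<2*K. e k)"
      unfolding error_count_def e_def by (simp add: Collect_conj_eq lessThan_def)
    also have "\<dots> = (\<Sum>k<K. e k + e (K + k))"
    proof -
      have "(\<Sum>k<K+j. e k) = (\<Sum>k<K. e k) + (\<Sum>k<j. e (K + k))" for j
        by (induction j) auto
      from this[of K] show ?thesis by (simp add: mult_2 sum.distrib)
    qed
    finally have err: "(\<Sum>k<K. e k + e (K + k)) \<le> \<alpha> * R"
      using that unfolding Good_def by simp
    have "\<alpha> * R = \<alpha> * \<rho> * (2 * K)"
      unfolding R_def by simp
    also have "\<dots> \<le> 1 / 4 * (2 * K)"
      using \<alpha> by (intro mult_right_mono) auto
    finally have "(\<Sum>k<K. e k + e (K + k)) \<le> K / 2" using err by simp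
    moreover have "(\<Sum>k<K. of_bool (g (u (w (Suc (K + k) * G)))) - of_bool (g (u (w (Suc k * G)))))
        = (if c then 1 else - 1) * (\<Sum>k<K. 1 - (e k + e (K + k)))"
      unfolding sum_distrib_left by (rule sum.cong[OF refl]) (auto simp: e_def z_def)
    then have "\<bar>\<Sum>k<K. of_bool (g (u (w (Suc (K + k) * G)))) - of_bool (g (u (w (Suc k * G))))\<bar>
        = \<bar>K - (\<Sum>k<K. e k + e (K + k))\<bar>"
      by (simp add: abs_mult sum_subtractf)
    ultimately show ?thesis by linarith
  qed
  have Good_prob: "measure (A (map (z \<circ> S) [0..<n]) (map (z \<circ> T) [0..<m])) Good \<le> \<gamma>"
    if S: "\<not> (\<exists>i<n. \<exists>j<i. S i = S j \<and> S i < 2 * K)" and T: "\<not> (\<exists>i<m. T i < 2 * K)" for S T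
  proof -
    have T': "map (z \<circ> T) [0..<m] = replicate m z\<^sub>0"
      using T by (auto simp: z_def intro!: replicate_eqI)
    have "i = j" if "i < n" "j < n" "S i = S j" "S i < 2 * K" for i j
      using S that by (cases i j rule: linorder_cases) auto
    then obtain \<sigma> s where \<sigma>: "\<sigma> \<in> patterns n" and s: "config n N s" "spaced n N G L s"
      and S': "map (z \<circ> S) [0..<n] = realise z\<^sub>0 (\<lambda>k. u (w (s k))) \<sigma>"
      and once: "\<And>i j k b b'. i < n \<Longrightarrow> j < n \<Longrightarrow> \<sigma> ! i = Some (k, b) \<Longrightarrow> \<sigma> ! j = Some (k, b') \<Longrightarrow> i = j"
      unfolding N_def
      by (rule sample_as_pattern[where z = z and z\<^sub>0 = z\<^sub>0 and K = "2 * K" and L = L and G = G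
            and x = "\<lambda>y. u (w y)" and lab = "\<lambda>k. (K \<le> k) = c" and S = S and n = n])
        (use LG in \<open>auto simp: z_def\<close>)
    interpret homogeneous_mechanism "\<lambda>s. B (realise z\<^sub>0 (\<lambda>k. u (w (s k))) \<sigma>)" MH
      "\<lambda>y g. g (u (w y))" n N \<eta> "max \<delta> 0"
      by (rule homogeneous_mechanism_realise[OF MH B dp hom[rule_format] inj _ \<sigma> once]) (use \<eta> in auto)
    have "measure (B (realise z\<^sub>0 (\<lambda>k. u (w (s k))) \<sigma>)) Good < \<gamma>"
    proof (rule not_accurate[OF n L0 LN s(1) K0 _ s(2) pt_N \<gamma> \<kappa>_def \<xi>_def \<xi>(1,2) _ K1(1)])
      show "(J + 2) * (L + 1) < G" unfolding G_def by simp
      show "J * \<xi> \<le> \<kappa>\<^sup>2 / 32" using \<xi>(3) J0 by (simp add: field_simps)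
      show "8 < J * \<kappa>" using J \<kappa> by (simp add: field_simps)
      \<comment> \<open>This is where the constant 256 comes from: 4 from \<gamma>, 16 from \<kappa>
        and 4 from the quarter.\<close>
      show "max \<delta> 0 \<le> \<kappa> / 4" using \<delta> \<kappa> unfolding \<kappa>_def \<gamma>_def by simp
      show "Good \<in> sets MH" unfolding Good_def by (rule error_count_sets[OF MH])
      show "K / 2 \<le> \<bar>\<Sum>k<K. X (Suc (K + k) * G) g - X (Suc k * G) g\<bar>" if "g \<in> Good" for g
        using Good_large[OF that] unfolding X_def .
    qed
    then show ?thesis unfolding S' T' B_def by simp
  qed
  have "1 - \<beta> \<le> \<gamma>
    + measure (\<Pi>\<^sub>M i\<in>{..<n}. uniform R) {S\<in>space (\<Pi>\<^sub>M i\<in>{..<n}. uniform R). \<exists>i<n. \<exists>j<i. S i = S j \<and> S i < 2 * K}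
    + measure (\<Pi>\<^sub>M i\<in>{..<m}. uniform R) {T\<in>space (\<Pi>\<^sub>M i\<in>{..<m}. uniform R). \<exists>i<m. T i < 2 * K}"
  proof (rule learner_on_indexed_examples[OF MX MH H A learner \<beta> R, where g = "h t" and z = z])
    show "h t \<in> H" using threshold_seqD(1)[OF th, of t] t by simp
    show "h t (fst (z k)) = snd (z k)" for k
      using label[of k] threshold_seqD(2)[OF th, of t M] t unfolding z_def z\<^sub>0_def by auto
    show "{S\<in>space (\<Pi>\<^sub>M i\<in>{..<n}. uniform R). \<exists>i<n. \<exists>j<i. S i = S j \<and> S i < 2 * K} \<in> sets (\<Pi>\<^sub>M i\<in>{..<n}. uniform R)"
      by (rule prob_index_collision(2)[OF R])
    show "{T\<in>space (\<Pi>\<^sub>M i\<in>{..<m}. uniform R). \<exists>i<m. T i < 2 * K} \<in> sets (\<Pi>\<^sub>M i\<in>{..<m}. uniform R)"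
      by (rule prob_index_hit(2)[OF R])
    show "0 \<le> \<gamma>" using \<gamma> by simp
  qed (use Good_prob in \<open>auto simp: Good_def\<close>)
  \<comment> \<open>As \<open>R = 2 * K * \<rho>\<close>, the collision bound decreases like
    \<open>1 / K\<close>, which is why \<open>K\<close> was also taken above
    \<open>n * n / \<gamma>\<close>.\<close>
  moreover have "(real n)\<^sup>2 * (2 * K) / (real R)\<^sup>2 \<le> \<gamma>"
  proof -
    have "(real n)\<^sup>2 * (2 * K) / (real R)\<^sup>2 = (real n)\<^sup>2 / K / (2 * (real \<rho>)\<^sup>2)"
      unfolding R_def using K0 by (simp add: power2_eq_square field_simps)
    also have "\<dots> \<le> (real n)\<^sup>2 / K / 1"
    proof (rule divide_left_mono)
      have "1 \<le> (real \<rho>)\<^sup>2" using \<rho>(1) by (intro one_le_power) simp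
      then show "1 \<le> 2 * (real \<rho>)\<^sup>2" by simp
    qed (use \<rho>(1) in auto)
    finally show ?thesis using K1(2) by simp
  qed
  moreover have "real (m * (2 * K)) / R \<le> \<gamma>"
    unfolding R_def \<gamma>_def using \<rho> K0 by simp
  moreover have False if "1 - \<beta> \<le> \<gamma> + x + y" "x \<le> x'" "x' \<le> \<gamma>" "y \<le> y'" "y' \<le> \<gamma>" for x x' y y' :: real
  proof -
    have "1 - \<beta> = 4 * \<gamma>" unfolding \<gamma>_def by simp
    with that(1) have "4 * \<gamma> \<le> \<gamma> + x + y" by (simp only:)
    moreover have "x + y \<le> \<gamma> + \<gamma>" using that(2-5) by (intro add_mono) auto
    ultimately show False using \<gamma> by simp
  qed
  ultimately show False
    using prob_index_collision(1)[OF R, of n] prob_index_hit(1)[OF R, of m] by blast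
qed

theorem theorem4p1:
  fixes MX :: "'x measure" and MH :: "('x \<Rightarrow> bool) measure"
    and H :: "('x \<Rightarrow> bool) set" and A :: "'x algo"
    and n_priv n_pub :: "real \<Rightarrow> real \<Rightarrow> nat"
  assumes "space MX = UNIV"
    and "hypothesis_space MX MH"
    and "H \<subseteq> space MH"
    and "littlestone_dim H = \<infinity>"
    and "semi_private_learner MX MH H A n_priv n_pub"
  shows "\<forall>\<beta>\<in>{0<..<1}. (\<lambda>\<alpha>. real (n_pub \<alpha> \<beta>)) \<in> \<Omega>[at_right 0](\<lambda>\<alpha>. 1 / \<alpha>)"
proof
  fix \<beta> :: real assume \<beta>: "\<beta> \<in> {0<..<1}"
  from assms(5) obtain \<delta> where A: "randomized_algorithm MX MH A" and \<delta>: "negligible_fun \<delta>"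
    and learner: "\<And>\<alpha>. \<alpha> \<in> {0<..<1} \<Longrightarrow>
      semi_private_learner_with MX MH H A (n_priv \<alpha> \<beta>) (n_pub \<alpha> \<beta>) \<alpha> \<beta> (1/10) (\<delta> (n_priv \<alpha> \<beta>))"
    using \<beta> unfolding semi_private_learner_def by blast
  have "\<delta> \<in> o(\<lambda>n. 1 / real n ^ 2)"
    using \<delta> unfolding negligible_fun_def by blast
  from landau_o.smallD[OF this, of "(1 - \<beta>) / 256"]
  have "\<forall>\<^sub>F n in sequentially. norm (\<delta> n) \<le> (1 - \<beta>) / 256 * norm (1 / real n ^ 2)"
    using \<beta> by simp
  then obtain n\<^sub>1 where n\<^sub>1: "\<And>n. n\<^sub>1 \<le> n \<Longrightarrow> norm (\<delta> n) \<le> (1 - \<beta>) / 256 * norm (1 / real n ^ 2)"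
    unfolding eventually_sequentially by blast
  define n\<^sub>0 where "n\<^sub>0 = Suc n\<^sub>1"
  obtain k :: nat where k: "2 / (1 - \<beta>) < k" using reals_Archimedean2 by blast
  \<comment> \<open>The aim is \<open>\<alpha> * \<rho> < 2 * d = 1 / (k + 4)\<close>, which is
    below \<open>1 / k\<close> and at most \<open>1 / 4\<close>, as the two cases require. One
    \<open>d\<close> is spent on the public sample through \<open>c\<close>, the other on
    \<open>n\<^sub>0\<close> and rounding through \<open>b\<close>; the minimum with 1 keeps
    \<alpha> below 1.\<close>
  define d where "d = 1 / (2 * (real k + 4))"
  define c where "c = d * (1 - \<beta>) / 4"
  define b where "b = min 1 (d / (4 * n\<^sub>0 / (1 - \<beta>) + 2))"
  have d: "d > 0" unfolding d_def by simp
  have c: "c > 0" unfolding c_def using d \<beta> by simp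
  have pos: "0 < 4 * n\<^sub>0 / (1 - \<beta>) + 2" using \<beta> by (intro add_nonneg_pos) auto
  have b: "b > 0" unfolding b_def using d pos by simp
  have "c * norm (1 / \<alpha>) \<le> norm (real (n_pub \<alpha> \<beta>))" if \<alpha>: "0 < \<alpha>" "\<alpha> < b" for \<alpha>
  proof (rule ccontr)
    assume "\<not> ?thesis"
    then have m: "\<alpha> * n_pub \<alpha> \<beta> < c"
      using \<alpha> by (simp add: field_simps)
    define m n where "m = n_pub \<alpha> \<beta>" and "n = n_priv \<alpha> \<beta>"
    \<comment> \<open>Large enough that a sample of up to \<open>m + n\<^sub>0\<close> draws is hit
      with probability at most \<open>(1 - \<beta>) / 4\<close>. This covers the public sample and a
      bounded private one.\<close>
    define \<rho> where "\<rho> = Suc (nat \<lceil>(m + n\<^sub>0) * 4 / (1 - \<beta>)\<rceil>)"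
    have "0 \<le> (m + n\<^sub>0) * 4 / (1 - \<beta>)" using \<beta> by simp
    then have \<rho>: "(m + n\<^sub>0) * 4 / (1 - \<beta>) \<le> \<rho>" "\<rho> \<le> (m + n\<^sub>0) * 4 / (1 - \<beta>) + 2"
      unfolding \<rho>_def by linarith+
    have \<rho>0: "\<rho> > 0" unfolding \<rho>_def by simp
    have *: "j / \<rho> \<le> (1 - \<beta>) / 4" if "j \<le> m + n\<^sub>0" for j
    proof -
      have "real j \<le> m + n\<^sub>0" using that by simp
      also have "\<dots> \<le> \<rho> * ((1 - \<beta>) / 4)" using \<rho>(1) \<beta> by (simp add: field_simps)
      finally show ?thesis using \<rho>0 by (simp add: field_simps)
    qed
    have "\<alpha> * \<rho> \<le> \<alpha> * ((m + n\<^sub>0) * 4 / (1 - \<beta>) + 2)"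
      using \<rho>(2) \<alpha> by (intro mult_left_mono) auto
    also have "\<dots> = (\<alpha> * m) * (4 / (1 - \<beta>)) + \<alpha> * (4 * n\<^sub>0 / (1 - \<beta>) + 2)"
      by (simp add: field_simps add_divide_distrib)
    also have "\<dots> < c * (4 / (1 - \<beta>)) + d"
    proof (rule add_strict_mono)
      show "(\<alpha> * m) * (4 / (1 - \<beta>)) < c * (4 / (1 - \<beta>))"
        using m \<beta> unfolding m_def by (intro mult_strict_right_mono) auto
      have "\<alpha> < d / (4 * n\<^sub>0 / (1 - \<beta>) + 2)" using \<alpha> unfolding b_def by simp
      then show "\<alpha> * (4 * n\<^sub>0 / (1 - \<beta>) + 2) < d" using pos by (simp only: pos_less_divide_eq)
    qed
    also have "\<dots> = 1 / (real k + 4)"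
    proof -
      have "c * (4 / (1 - \<beta>)) = d" unfolding c_def using \<beta> by simp
      moreover have "d + d = 1 / (real k + 4)" unfolding d_def by (simp add: field_simps)
      ultimately show ?thesis by (simp only:)
    qed
    finally have \<alpha>\<rho>: "\<alpha> * \<rho> < 1 / (real k + 4)" .
    have learner': "semi_private_learner_with MX MH H A n m \<alpha> \<beta> (1/10) (\<delta> n)"
      unfolding n_def m_def using \<alpha> b by (intro learner) (auto simp: b_def)
    \<comment> \<open>Negligibility controls \<delta> only from \<open>n\<^sub>0\<close> on; a
      smaller private sample is covered by the choice of \<rho>.\<close>
    show False
    proof (cases "n < n\<^sub>0")
      case True
      show False
      proof (rule no_learner_with_small_samples[OF assms(1-4) A learner' _ \<rho>0])
        show "2 < k * (1 - \<beta>)" using k \<beta> by (simp add: field_simps)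
        have "\<alpha> * \<rho> * k \<le> 1 / (real k + 4) * k"
          using \<alpha>\<rho> by (intro mult_right_mono) auto
        also have "\<dots> < 1" by (simp add: field_simps)
        finally show "\<alpha> * \<rho> * k < 1" .
      qed (use \<beta> * True in auto)
    next
      case False
      show False
      proof (rule no_learner_with_negligible_delta[OF assms(1-4) A learner' _ _ \<rho>0])
        show "n > 0" using False unfolding n\<^sub>0_def by simp
        have "1 / (real k + 4) \<le> 1 / 4" by (simp add: field_simps)
        then show "\<alpha> * \<rho> \<le> 1 / 4" using \<alpha>\<rho> by linarith
        show "\<delta> n \<le> (1 - \<beta>) / (256 * (real n)\<^sup>2)"
          using n\<^sub>1[of n] False unfolding n\<^sub>0_def by simp
      qed (use \<beta> * in auto)
    qed
  qed
  then have "\<forall>\<^sub>F \<alpha> in at_right 0. c * norm (1 / \<alpha>) \<le> norm (real (n_pub \<alpha> \<beta>))"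
    using b unfolding eventually_at_right_field by blast
  then show "(\<lambda>\<alpha>. real (n_pub \<alpha> \<beta>)) \<in> \<Omega>[at_right 0](\<lambda>\<alpha>. 1 / \<alpha>)"
    by (rule landau_omega.bigI[OF c])
qed

end
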